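(* Let $\mathcal{F}$ be an $(\alpha,\beta)$-smooth family of bipartite graphs with $2>\alpha>\beta\ge 1$. Then there exists $k_0$ such that for every odd integer $k\ge k_0$, every extremal $\mathcal{F}\cup\{C_k\}$-free family of graphs is near-bipartite.
   Context: For a family $\mathcal{H}$ of graphs, a graph is $\mathcal{H}$-free if it contains no member of $\mathcal{H}$ as a (not necessarily induced) subgraph; $\mathrm{ex}(n,\mathcal{H})$ is the maximum number of edges in an $\mathcal{H}$-free graph on $n$ vertices. $C_k$ denotes the cycle of length $k$. For a family $\mathcal{F}$ of bipartite graphs, $z(m,n,\mathcal{F})$ denotes the maximum number of edges in an $\mathcal{F}$-free bipartite graph with parts of sizes $m$ and $n$. For reals $1\le\beta<\alpha<2$, $\mathcal{F}$ is $(\alpha,\beta)$-smooth if there is $\rho\ge 0$ such that for all $m\le n$, $z(m,n,\mathcal{F})=\rho m n^{\alpha-1}+O(n^{\beta})$ (asymptotics as $n\to\infty$, uniformly in $m\le n$); $\rho$ is called the relative density. An extremal $\mathcal{H}$-free family of graphs is a family consisting of, for each $n$, an $n$-vertex $\mathcal{H}$-free graph with exactly $\mathrm{ex}(n,\mathcal{H})$ edges. A family $\mathcal{G}$ of graphs is near-bipartite if every $n$-vertex graph $G\in\mathcal{G}$ has a bipartite subgraph $H$ with $e(H)/e(G)\to 1$ as $n\to\infty$.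
   Formalization: The relative density ρ is assumed positive; with ρ = 0 the claim fails: for F = {K_{1,3}}, α = 3/2, β = 1, odd k ≥ 5 and 3 | n, disjoint triangles are extremal but have no bipartite subgraph with more than 2/3 of the edges. *)

theory Defs
  imports Complex_Main
begin

type_synonym 'a graph = "'a set \<times> 'a set set"

abbreviation verts :: "'a graph \<Rightarrow> 'a set" where "verts \<equiv> fst"
abbreviation edges :: "'a graph \<Rightarrow> 'a set set" where "edges \<equiv> snd"

definition simple_graph :: "'a graph \<Rightarrow> bool" where
  "simple_graph G \<longleftrightarrow> finite (verts G) \<and> (\<forall>e\<in>edges G. e \<subseteq> verts G \<and> card e = 2)"

definition is_subgraph :: "'a graph \<Rightarrow> 'a graph \<Rightarrow> bool" where
  "is_subgraph H G \<longleftrightarrow> simple_graph H \<and> verts H \<subseteq> verts G \<and> edges H \<subseteq> edges G"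

definition bipartition :: "'a graph \<Rightarrow> 'a set \<Rightarrow> 'a set \<Rightarrow> bool" where
  "bipartition G A B \<longleftrightarrow> A \<union> B = verts G \<and> A \<inter> B = {} \<and>
     (\<forall>e\<in>edges G. \<exists>a\<in>A. \<exists>b\<in>B. e = {a, b})"

definition bipartite :: "'a graph \<Rightarrow> bool" where
  "bipartite G \<longleftrightarrow> (\<exists>A B. bipartition G A B)"

text \<open>\<open>G\<close> has a (not necessarily induced) subgraph isomorphic to \<open>H\<close>.\<close>

definition contains_copy :: "'a graph \<Rightarrow> 'b graph \<Rightarrow> bool" where
  "contains_copy G H \<longleftrightarrow>
     (\<exists>f. inj_on f (verts H) \<and> f ` verts H \<subseteq> verts G \<and> (\<forall>e\<in>edges H. f ` e \<in> edges G))"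

definition graph_free :: "'b graph set \<Rightarrow> 'a graph \<Rightarrow> bool" where
  "graph_free \<H> G \<longleftrightarrow> (\<forall>H\<in>\<H>. \<not> contains_copy G H)"

text \<open>A cycle for \<open>k \<ge> 3\<close> only.\<close>

definition cycle_graph :: "nat \<Rightarrow> nat graph" where
  "cycle_graph k = ({..<k}, {{i, Suc i mod k} | i. i < k})"

text \<open>Since every finite graph is isomorphic to one with vertices in \<^typ>\<open>nat\<close>, the maxima
  below may range over such graphs. When no \<open>\<H>\<close>-free graph of the given size exists (possible
  only if \<open>\<H>\<close> has an edgeless member), \<^const>\<open>Max\<close> is taken of the empty set; there is
  then no extremal family either.\<close>

definition ex_number :: "nat \<Rightarrow> 'b graph set \<Rightarrow> nat" where
  "ex_number n \<H> = Max {card (edges G) | G :: nat graph.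
     simple_graph G \<and> card (verts G) = n \<and> graph_free \<H> G}"

definition zarankiewicz :: "nat \<Rightarrow> nat \<Rightarrow> 'b graph set \<Rightarrow> nat" where
  "zarankiewicz m n \<F> = Max {card (edges G) | (G :: nat graph) A B.
     simple_graph G \<and> bipartition G A B \<and> card A = m \<and> card B = n \<and> graph_free \<F> G}"

text \<open>\<open>\<F>\<close> is \<open>(\<alpha>, \<beta>)\<close>-smooth with relative density \<open>\<rho>\<close>. The implied constant is uniform
  in \<open>m \<le> n\<close>.\<close>

definition smooth_with_density :: "real \<Rightarrow> real \<Rightarrow> real \<Rightarrow> 'b graph set \<Rightarrow> bool" where
  "smooth_with_density \<alpha> \<beta> \<rho> \<F> \<longleftrightarrow> \<rho> \<ge> 0 \<and>
     (\<exists>C N. \<forall>n\<ge>N. \<forall>m\<le>n.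
        \<bar>real (zarankiewicz m n \<F>) - \<rho> * real m * real n powr (\<alpha> - 1)\<bar> \<le> C * real n powr \<beta>)"

definition extremal_family :: "'b graph set \<Rightarrow> (nat \<Rightarrow> nat graph) \<Rightarrow> bool" where
  "extremal_family \<H> G \<longleftrightarrow> (\<forall>n. simple_graph (G n) \<and> card (verts (G n)) = n \<and>
     graph_free \<H> (G n) \<and> card (edges (G n)) = ex_number n \<H>)"

text \<open>The limit is taken along the members of \<open>\<G>\<close> as their number of vertices tends to
  infinity.\<close>

definition near_bipartite :: "'a graph set \<Rightarrow> bool" where
  "near_bipartite \<G> \<longleftrightarrow>
     (\<exists>H. (\<forall>G\<in>\<G>. is_subgraph (H G) G \<and> bipartite (H G)) \<and>
        ((\<lambda>G. real (card (edges (H G))) / real (card (edges G))) \<longlongrightarrow> 1)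
          (inf (filtercomap (\<lambda>G. card (verts G)) at_top) (principal \<G>)))"

end

theory Submission
  imports Defs "HOL-Real_Asymp.Real_Asymp"
begin

text \<open>
  In an extremal graph on \<open>n\<close> vertices choose a vertex set \<open>X\<close> maximising \<open>e(X) / |X| powr \<gamma>\<close>
  for some \<open>1 < \<gamma> < \<alpha>\<close>. Maximality makes every cut of \<open>X\<close> dense, and smoothness bounds
  the number of edges between a set and its neighbourhood from above. Hence in the graph induced on \<open>X\<close>
  each step of a ball either multiplies its size by a fixed power of \<open>|X|\<close> or gains a
  constant proportion of \<open>|X|\<close>, so the radius \<open>R\<close> is bounded in terms of the smoothness data
  alone. If \<open>k > 2R\<close> is odd and many edges lie inside the breadth-first layers, a path
  in one layer closes up through the tree to a cycle of length exactly \<open>k\<close>. So all but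
  \<open>O(|X|)\<close> edges join consecutive layers and form a bipartite graph. Its size is at most
  about \<open>\<rho> (|X| / 2) powr \<alpha>\<close>, and comparison with \<open>ex(n) \<ge> (1 - o(1)) \<rho> (n / 2) powr \<alpha>\<close>
  gives \<open>|X| / n \<rightarrow> 1\<close>.
\<close>

section \<open>Finite graphs\<close>

lemma simple_graph_finite_edges:
  assumes "simple_graph G" shows "finite (edges G)"
proof -
  have "edges G \<subseteq> Pow (verts G)" "finite (verts G)"
    using assms by (auto simp: simple_graph_def)
  then show ?thesis by (meson finite_Pow_iff finite_subset)
qed

lemma simple_graph_card_edges_le:
  assumes "simple_graph G" shows "card (edges G) \<le> card (verts G) ^ 2"
proof -
  have fin: "finite (verts G)" using assms by (simp add: simple_graph_def)
  have "edges G \<subseteq> (\<lambda>(x, y). {x, y}) ` (verts G \<times> verts G)"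
  proof
    fix e assume "e \<in> edges G"
    then have "e \<subseteq> verts G" "card e = 2" using assms by (auto simp: simple_graph_def)
    then show "e \<in> (\<lambda>(x, y). {x, y}) ` (verts G \<times> verts G)"
      by (force simp: card_2_iff)
  qed
  then have "card (edges G) \<le> card (verts G \<times> verts G)"
    by (meson card_image_le card_mono fin finite_SigmaI finite_imageI order_trans)
  then show ?thesis by (simp add: card_cartesian_product power2_eq_square)
qed

lemma simple_graph_edgeD:
  assumes "simple_graph G" "{u, w} \<in> edges G"
  shows "u \<in> verts G" "w \<in> verts G" "u \<noteq> w"
  using assms by (auto simp: simple_graph_def)

lemma graph_free_subgraph:
  assumes "is_subgraph H G" "graph_free \<F> G" shows "graph_free \<F> H"
  unfolding graph_free_def
proof (intro ballI notI)
  fix F assume "F \<in> \<F>" "contains_copy H F"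
  then obtain f where "inj_on f (verts F)" "f ` verts F \<subseteq> verts H" "\<forall>e\<in>edges F. f ` e \<in> edges H"
    unfolding contains_copy_def by blast
  then have "contains_copy G F"
    unfolding contains_copy_def using assms(1)
    by (intro exI[of _ f]) (auto simp: is_subgraph_def)
  then show False using \<open>F \<in> \<F>\<close> assms(2) by (auto simp: graph_free_def)
qed

section \<open>Cuts, induced subgraphs and Zarankiewicz bounds\<close>

definition cut :: "'a graph \<Rightarrow> 'a set \<Rightarrow> 'a set \<Rightarrow> 'a set set" where
  "cut G X Y = {e \<in> edges G. \<exists>x\<in>X. \<exists>y\<in>Y. e = {x, y}}"

definition induced :: "'a graph \<Rightarrow> 'a set \<Rightarrow> 'a graph" where
  "induced G X = (X, {e \<in> edges G. e \<subseteq> X})"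

lemma verts_induced [simp]: "verts (induced G X) = X"
  by (simp add: induced_def)

lemma induced_subgraph:
  assumes "simple_graph G" "X \<subseteq> verts G" shows "is_subgraph (induced G X) G"
  using assms by (auto simp: is_subgraph_def induced_def simple_graph_def finite_subset)

lemma simple_graph_induced:
  assumes "simple_graph G" "X \<subseteq> verts G" shows "simple_graph (induced G X)"
  using induced_subgraph[OF assms] by (simp add: is_subgraph_def)

lemma is_subgraph_trans:
  assumes "is_subgraph H K" "is_subgraph K G" shows "is_subgraph H G"
  using assms by (auto simp: is_subgraph_def)

text \<open>The edge counts over which \<open>zarankiewicz\<close> maximises are at most the square
  of the number of vertices, so \<open>Max\<close> is taken over a finite set and dominates each
  member.\<close>

lemma card_edges_bipartition_le_zarankiewicz:
  fixes G :: "nat graph"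
  assumes "simple_graph G" "bipartition G A B" "graph_free \<F> G"
  shows "card (edges G) \<le> zarankiewicz (card A) (card B) \<F>"
proof -
  let ?S = "{card (edges G) | (G :: nat graph) A' B'.
     simple_graph G \<and> bipartition G A' B' \<and> card A' = card A \<and> card B' = card B \<and> graph_free \<F> G}"
  have "?S \<subseteq> {..(card A + card B) ^ 2}"
  proof
    fix c assume "c \<in> ?S"
    then obtain H :: "nat graph" and A' B' where H: "simple_graph H" "bipartition H A' B'"
      "card A' = card A" "card B' = card B" and c: "c = card (edges H)" by blast
    then have "card (verts H) \<le> card A' + card B'"
      by (metis bipartition_def card_Un_le)
    then have "card (verts H) ^ 2 \<le> (card A + card B) ^ 2"
      using H by (simp add: power_mono)
    then have "card (edges H) \<le> (card A + card B) ^ 2"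
      using simple_graph_card_edges_le[OF H(1)] by linarith
    then show "c \<in> {..(card A + card B) ^ 2}" by (simp add: c)
  qed
  then have "finite ?S" using finite_subset by blast
  then show ?thesis
    unfolding zarankiewicz_def using assms by (intro Max_ge) blast+
qed

lemma card_cut_le_zarankiewicz:
  fixes G :: "nat graph"
  assumes "simple_graph G" "graph_free \<F> G" "X \<subseteq> verts G" "Y \<subseteq> verts G" "X \<inter> Y = {}"
  shows "card (cut G X Y) \<le> zarankiewicz (card X) (card Y) \<F>"
proof -
  let ?H = "(X \<union> Y, cut G X Y)"
  have "is_subgraph ?H G"
    using assms by (auto simp: is_subgraph_def cut_def simple_graph_def finite_subset)
  moreover have "bipartition ?H X Y"
    using assms by (auto simp: bipartition_def cut_def)
  ultimately show ?thesis
    using card_edges_bipartition_le_zarankiewicz[of ?H X Y] graph_free_subgraph[of ?H G] assms(2)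
    by (auto simp: is_subgraph_def)
qed

text \<open>Membership in one part alternates along the cycle, so for odd \<open>k\<close> the
  vertices \<open>f 0\<close> and \<open>f (k - 1)\<close> would lie on the same side although they
  are adjacent. This is what lets bipartite graphs compete for the extremal number.\<close>

lemma bipartite_no_odd_cycle:
  assumes "bipartite G" "odd k" shows "\<not> contains_copy G (cycle_graph k)"
proof
  assume "contains_copy G (cycle_graph k)"
  then obtain f where f: "\<forall>e\<in>edges (cycle_graph k). f ` e \<in> edges G"
    by (auto simp: contains_copy_def)
  obtain A B where AB: "A \<inter> B = {}" "\<forall>e\<in>edges G. \<exists>a\<in>A. \<exists>b\<in>B. e = {a, b}"
    using assms(1) by (auto simp: bipartite_def bipartition_def)
  have step: "f (Suc i mod k) \<in> A \<longleftrightarrow> f i \<notin> A" if "i < k" for i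
  proof -
    have "{i, Suc i mod k} \<in> edges (cycle_graph k)"
      using that unfolding cycle_graph_def snd_conv by blast
    then have "f ` {i, Suc i mod k} \<in> edges G" using f by blast
    then obtain a b where "a \<in> A" "b \<in> B" "{f i, f (Suc i mod k)} = {a, b}"
      using AB by auto
    then show ?thesis using AB(1) by (metis disjoint_iff doubleton_eq_iff)
  qed
  have "i < k \<Longrightarrow> f i \<in> A \<longleftrightarrow> (f 0 \<in> A \<longleftrightarrow> even i)" for i
  proof (induction i)
    case (Suc i)
    then show ?case using step[of i] by auto
  qed simp
  from this[of "k - 1"] have "f (k - 1) \<in> A \<longleftrightarrow> f 0 \<in> A"
    using assms(2) by (auto elim: oddE)
  moreover have "f 0 \<in> A \<longleftrightarrow> f (k - 1) \<notin> A"
    using step[of "k - 1"] assms(2) by (cases k) auto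
  ultimately show False by simp
qed

text \<open>The max-cut bound for a multigraph: \<open>g\<close> gives the ends of an edge and may
  identify edges, as happens when edges are projected to ancestors. On adding a vertex
  \<open>x\<close>, edges avoiding \<open>x\<close> do not notice whether \<open>x\<close> joins
  \<open>S\<close>, and each edge at \<open>x\<close> is split by one of \<open>S\<close> and
  \<open>insert x S\<close>; hence one of the two choices splits half of all edges.\<close>

lemma exists_splitting_set:
  assumes "finite U" "finite E" "\<And>e. e \<in> E \<Longrightarrow> g e \<subseteq> U \<and> card (g e) = 2"
  shows "\<exists>S\<subseteq>U. card E \<le> 2 * card {e \<in> E. card (g e \<inter> S) = 1}"
  using assms
proof (induction U arbitrary: E rule: finite_induct)
  case empty
  then have "E = {}" by fastforce
  then show ?case by simp
next
  case (insert x U)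
  define E0 where "E0 = {e \<in> E. x \<notin> g e}"
  define E1 where "E1 = {e \<in> E. x \<in> g e}"
  have fin: "finite E0" "finite E1" using insert.prems by (auto simp: E0_def E1_def)
  have E: "E = E0 \<union> E1" "E0 \<inter> E1 = {}" by (auto simp: E0_def E1_def)
  have "\<exists>S\<subseteq>U. card E0 \<le> 2 * card {e \<in> E0. card (g e \<inter> S) = 1}"
    using insert.prems(2) fin by (intro insert.IH) (fastforce simp: E0_def)+
  then obtain S where S: "S \<subseteq> U" "card E0 \<le> 2 * card {e \<in> E0. card (g e \<inter> S) = 1}" by blast
  let ?S' = "insert x S"
  have split: "{e \<in> E. card (g e \<inter> T) = 1} = {e \<in> E0. card (g e \<inter> T) = 1} \<union> {e \<in> E1. card (g e \<inter> T) = 1}" for T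
    using E by auto
  have c: "card {e \<in> E. card (g e \<inter> T) = 1} = card {e \<in> E0. card (g e \<inter> T) = 1} + card {e \<in> E1. card (g e \<inter> T) = 1}" for T
    unfolding split using fin E by (intro card_Un_disjoint) auto
  have e0: "{e \<in> E0. card (g e \<inter> ?S') = 1} = {e \<in> E0. card (g e \<inter> S) = 1}"
    by (auto simp: E0_def)
  have "E1 \<subseteq> {e \<in> E1. card (g e \<inter> S) = 1} \<union> {e \<in> E1. card (g e \<inter> ?S') = 1}"
  proof -
    have "card (g e \<inter> S) = 1 \<or> card (g e \<inter> ?S') = 1" if "e \<in> E1" for e
    proof -
      have "card (g e) = 2" "x \<in> g e" using that insert.prems(2)[of e] by (auto simp: E1_def)
      then obtain y where y: "g e = {x, y}" "y \<noteq> x"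
        by (metis card_2_iff insertE insert_commute singletonD)
      have "x \<notin> S" using S insert.hyps by auto
      then show ?thesis using y by (cases "y \<in> S") (auto simp: Int_insert_left)
    qed
    then show ?thesis by auto
  qed
  then have "card E1 \<le> card {e \<in> E1. card (g e \<inter> S) = 1} + card {e \<in> E1. card (g e \<inter> ?S') = 1}"
    using fin by (intro order_trans[OF card_mono card_Un_le]) auto
  moreover have "card E = card E0 + card E1" using fin E card_Un_disjoint by blast
  ultimately have "card E \<le> 2 * card {e \<in> E. card (g e \<inter> S) = 1} \<or> card E \<le> 2 * card {e \<in> E. card (g e \<inter> ?S') = 1}"
    using S(2) c[of S] c[of ?S'] unfolding e0 by arith
  then show ?case using S(1) by (meson insert_mono order.trans subset_insertI)
qed

text \<open>A path with at most \<open>l\<close> vertices extends at its head, which has more than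
  \<open>l\<close> neighbours and so one off the path.\<close>

lemma greedy_path:
  assumes "finite U" "U \<noteq> {}"
    and deg: "\<And>x. x \<in> U \<Longrightarrow> card {y \<in> U. {x, y} \<in> E} > l"
  shows "j \<le> l \<Longrightarrow> \<exists>xs. distinct xs \<and> length xs = Suc j \<and> set xs \<subseteq> U \<and>
    successively (\<lambda>a b. {a, b} \<in> E) xs"
proof (induction j)
  case 0
  obtain x where "x \<in> U" using assms by auto
  then show ?case by (intro exI[of _ "[x]"]) auto
next
  case (Suc j)
  then obtain xs where xs: "distinct xs" "length xs = Suc j" "set xs \<subseteq> U"
    "successively (\<lambda>a b. {a, b} \<in> E) xs" by auto
  have hd: "hd xs \<in> U" using xs by (cases xs) auto
  have "card (set xs) \<le> l" using xs Suc.prems distinct_card[of xs] by simp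
  then have "\<not> {y \<in> U. {hd xs, y} \<in> E} \<subseteq> set xs"
    using deg[OF hd] card_mono[OF finite_set, of "{y \<in> U. {hd xs, y} \<in> E}" xs] by linarith
  then obtain y where y: "y \<in> U" "{hd xs, y} \<in> E" "y \<notin> set xs" by auto
  then show ?case using xs
    by (intro exI[of _ "y # xs"]) (auto simp: successively_Cons insert_commute)
qed

text \<open>Deleting a vertex of degree at most \<open>l\<close> preserves the inequality between
  edges and vertices. By induction this reduces to the case in which all degrees exceed
  \<open>l\<close>, where the greedy path exists.\<close>

lemma many_edges_imp_path:
  assumes "finite U" "\<And>e. e \<in> E \<Longrightarrow> e \<subseteq> U \<and> card e = 2" "card E > l * card U"
  shows "\<exists>xs. distinct xs \<and> length xs = Suc l \<and> set xs \<subseteq> U \<and>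
    successively (\<lambda>a b. {a, b} \<in> E) xs"
  using assms
proof (induction "card U" arbitrary: U E rule: less_induct)
  case less
  have finE: "finite E" using less.prems by (intro finite_subset[of E "Pow U"]) auto
  have "E \<noteq> {}" using less.prems(3) by auto
  then have ne: "U \<noteq> {}" using less.prems(2) by fastforce
  show ?case
  proof (cases "\<forall>x\<in>U. card {y \<in> U. {x, y} \<in> E} > l")
    case True
    then show ?thesis using greedy_path[OF less.prems(1) ne, of l E l] by auto
  next
    case False
    then obtain x where x: "x \<in> U" "card {y \<in> U. {x, y} \<in> E} \<le> l" by force
    define E1 where "E1 = {e \<in> E. x \<in> e}"
    have "E1 \<subseteq> (\<lambda>y. {x, y}) ` {y \<in> U. {x, y} \<in> E}"
    proof
      fix e assume e: "e \<in> E1"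
      then have "card e = 2" "e \<subseteq> U" "x \<in> e" "e \<in> E" using less.prems(2) by (auto simp: E1_def)
      then obtain y where "e = {x, y}" by (auto simp: card_2_iff)
      then show "e \<in> (\<lambda>y. {x, y}) ` {y \<in> U. {x, y} \<in> E}"
        using \<open>e \<subseteq> U\<close> \<open>e \<in> E\<close> by auto
    qed
    then have "card E1 \<le> card {y \<in> U. {x, y} \<in> E}"
      using surj_card_le[of "{y \<in> U. {x, y} \<in> E}" E1] less.prems(1) by simp
    then have E1: "card E1 \<le> l" using x by simp
    have "card (E - E1) = card E - card E1"
      using finE by (intro card_Diff_subset) (auto simp: E1_def)
    moreover have cU: "card U = Suc (card (U - {x}))"
      using x less.prems(1) by (metis card_Suc_Diff1)
    ultimately have "card (E - E1) > l * card (U - {x})"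
      using E1 less.prems(3) by simp
    moreover have "e \<subseteq> U - {x} \<and> card e = 2" if "e \<in> E - E1" for e
      using that less.prems(2) by (auto simp: E1_def)
    ultimately obtain xs where "distinct xs \<and> length xs = Suc l \<and> set xs \<subseteq> U - {x} \<and>
        successively (\<lambda>a b. {a, b} \<in> E - E1) xs"
      using less.hyps[of "U - {x}" "E - E1"] cU less.prems(1) by auto
    then show ?thesis by (intro exI[of _ xs]) (auto elim: successively_mono)
  qed
qed

lemma contains_cycle_of_list:
  assumes "distinct xs" "length xs = k" "set xs \<subseteq> verts G"
    "successively (\<lambda>a b. {a, b} \<in> edges G) xs" "{last xs, hd xs} \<in> edges G"
  shows "contains_copy G (cycle_graph k)"
  unfolding contains_copy_def
proof (intro exI[of _ "\<lambda>i. xs ! i"] conjI ballI)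
  show "inj_on ((!) xs) (verts (cycle_graph k))"
    using assms by (auto simp: cycle_graph_def inj_on_nth)
  show "(!) xs ` verts (cycle_graph k) \<subseteq> verts G"
    using assms by (auto simp: cycle_graph_def)
  fix e assume "e \<in> edges (cycle_graph k)"
  then obtain i where i: "e = {i, Suc i mod k}" "i < k" by (auto simp: cycle_graph_def)
  show "(!) xs ` e \<in> edges G"
  proof (cases "Suc i < k")
    case True
    then show ?thesis using assms i by (auto simp: successively_conv_nth)
  next
    case False
    then have k: "k = Suc i" using i by simp
    then have "xs \<noteq> []" using assms by auto
    then show ?thesis using assms i k by (simp add: last_conv_nth hd_conv_nth)
  qed
qed

section \<open>Breadth-first layers\<close>

primrec ball :: "'a graph \<Rightarrow> 'a \<Rightarrow> nat \<Rightarrow> 'a set" where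
  "ball G v 0 = {v}"
| "ball G v (Suc i) = ball G v i \<union> {u. \<exists>w\<in>ball G v i. {w, u} \<in> edges G}"

lemma ball_mono: "i \<le> j \<Longrightarrow> ball G v i \<subseteq> ball G v j"
  by (induction j) (auto simp: le_Suc_eq)

lemma ball_subset_verts:
  assumes "simple_graph G" "v \<in> verts G" shows "ball G v i \<subseteq> verts G"
  using assms by (induction i) (auto dest: simple_graph_edgeD)

lemma ball_trans: "\<lbrakk>x \<in> ball G v i; y \<in> ball G x j\<rbrakk> \<Longrightarrow> y \<in> ball G v (i + j)"
  by (induction j arbitrary: y) auto

lemma ball_sym: "x \<in> ball G v i \<Longrightarrow> v \<in> ball G x i"
proof (induction i arbitrary: x)
  case (Suc i)
  show ?case
  proof (cases "x \<in> ball G v i")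
    case True
    then show ?thesis using Suc.IH by simp
  next
    case False
    then obtain w where w: "w \<in> ball G v i" "{w, x} \<in> edges G" using Suc.prems by auto
    then have "w \<in> ball G x 1" by (auto simp: insert_commute)
    then have "v \<in> ball G x (1 + i)" using Suc.IH[OF w(1)] ball_trans by fast
    then show ?thesis by simp
  qed
qed simp

text \<open>Two balls that each hold more than half of the vertices meet, so any two vertices are
  joined through a common point of their balls.\<close>

lemma ball_large_imp_eq_verts:
  assumes "simple_graph G" "v \<in> verts G"
    and large: "\<And>u. u \<in> verts G \<Longrightarrow> card (verts G) < 2 * card (ball G u D)"
  shows "ball G v (2 * D) = verts G"
proof
  show "ball G v (2 * D) \<subseteq> verts G" using ball_subset_verts assms by metis
  show "verts G \<subseteq> ball G v (2 * D)"
  proof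
    fix u assume u: "u \<in> verts G"
    have fin: "finite (verts G)" using assms by (simp add: simple_graph_def)
    have "ball G v D \<inter> ball G u D \<noteq> {}"
    proof
      assume "ball G v D \<inter> ball G u D = {}"
      then have "card (ball G v D) + card (ball G u D) = card (ball G v D \<union> ball G u D)"
        using fin assms u ball_subset_verts by (metis card_Un_disjoint finite_subset)
      also have "\<dots> \<le> card (verts G)"
        using fin assms u ball_subset_verts by (metis card_mono Un_least)
      finally show False using large[OF u] large[OF assms(2)] by linarith
    qed
    then obtain x where "x \<in> ball G v D" "x \<in> ball G u D" by auto
    then have "u \<in> ball G v (D + D)" using ball_sym ball_trans by fast
    then show "u \<in> ball G v (2 * D)" by (simp add: mult_2)
  qed
qed

section \<open>Levels and the breadth-first tree\<close>

definition level :: "'a graph \<Rightarrow> 'a \<Rightarrow> 'a \<Rightarrow> nat" where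
  "level G v u = (LEAST i. u \<in> ball G v i)"

text \<open>One fixed choice of a neighbour one level closer to the root. Below the root these
  choices form a breadth-first tree, and the iterates of \<open>parent\<close> are the
  ancestors.\<close>

definition parent :: "'a graph \<Rightarrow> 'a \<Rightarrow> 'a \<Rightarrow> 'a" where
  "parent G v u = (SOME w. {w, u} \<in> edges G \<and> level G v u = Suc (level G v w))"

lemma level_le: "u \<in> ball G v i \<Longrightarrow> level G v u \<le> i"
  by (simp add: level_def Least_le)

lemma mem_ball_level: "u \<in> ball G v i \<Longrightarrow> u \<in> ball G v (level G v u)"
  unfolding level_def by (rule LeastI)

text \<open>Since the ball of radius \<open>R\<close> is everything, every vertex has a genuine
  level and \<open>R\<close> bounds the depth of the tree.\<close>

locale rooted_graph =
  fixes G :: "'a graph" and v :: 'a and R :: nat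
  assumes simple: "simple_graph G"
    and root: "v \<in> verts G"
    and reach: "ball G v R = verts G"
begin

abbreviation "lev \<equiv> level G v"
abbreviation "par \<equiv> parent G v"

lemma lev_le: "u \<in> verts G \<Longrightarrow> lev u \<le> R"
  using reach level_le by metis

lemma mem_ball_lev: "u \<in> verts G \<Longrightarrow> u \<in> ball G v (lev u)"
  using reach mem_ball_level by metis

lemma lev_eq_0: "u \<in> verts G \<Longrightarrow> lev u = 0 \<Longrightarrow> u = v"
  using mem_ball_lev[of u] by simp

lemma lev_adj_le:
  assumes "{u, w} \<in> edges G" shows "lev w \<le> Suc (lev u)"
proof -
  have "u \<in> ball G v (lev u)" using assms simple mem_ball_lev simple_graph_edgeD by metis
  then have "w \<in> ball G v (Suc (lev u))" using assms by auto
  then show ?thesis by (rule level_le)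
qed

lemma par:
  assumes "u \<in> verts G" "lev u = Suc t"
  shows "{par u, u} \<in> edges G" "lev (par u) = t" "par u \<in> verts G"
proof -
  have "u \<in> ball G v (Suc t)" using mem_ball_lev assms by metis
  moreover have "u \<notin> ball G v t" using level_le[of u G v t] assms by auto
  ultimately obtain w where w: "w \<in> ball G v t" "{w, u} \<in> edges G" by auto
  then have "lev w \<le> t" "Suc t \<le> Suc (lev w)"
    using level_le lev_adj_le assms by metis+
  then have "{w, u} \<in> edges G \<and> lev u = Suc (lev w)" using w assms by simp
  then have *: "{par u, u} \<in> edges G \<and> lev u = Suc (lev (par u))"
    unfolding parent_def by (rule someI)
  then show "{par u, u} \<in> edges G" "lev (par u) = t" using assms by auto
  then show "par u \<in> verts G" using simple simple_graph_edgeD by metis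
qed

lemma par_pow:
  assumes "u \<in> verts G" "j \<le> lev u"
  shows "(par ^^ j) u \<in> verts G" "lev ((par ^^ j) u) = lev u - j"
proof -
  have "(par ^^ j) u \<in> verts G \<and> lev ((par ^^ j) u) = lev u - j"
    using assms(2)
  proof (induction j)
    case (Suc j)
    then have "lev ((par ^^ j) u) = Suc (lev u - Suc j)" "(par ^^ j) u \<in> verts G" by auto
    then show ?case using par by simp
  qed (use assms in simp)
  then show "(par ^^ j) u \<in> verts G" "lev ((par ^^ j) u) = lev u - j" by auto
qed

lemma par_pow_edge:
  assumes "u \<in> verts G" "Suc j \<le> lev u"
  shows "{(par ^^ Suc j) u, (par ^^ j) u} \<in> edges G"
proof -
  have "lev ((par ^^ j) u) = Suc (lev u - Suc j)" "(par ^^ j) u \<in> verts G"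
    using par_pow[of u j] assms by auto
  then show ?thesis using par by simp
qed

text \<open>Ancestor lines that have met stay together, so lines still apart at height
  \<open>m\<close> are apart at every lower height.\<close>

lemma par_pow_neq:
  assumes "(par ^^ m) u \<noteq> (par ^^ m) w" "j \<le> m"
  shows "(par ^^ j) u \<noteq> (par ^^ j) w"
proof
  assume "(par ^^ j) u = (par ^^ j) w"
  then have "(par ^^ (m - j)) ((par ^^ j) u) = (par ^^ (m - j)) ((par ^^ j) w)" by simp
  then show False using assms by (simp add: funpow_add[symmetric, THEN fun_cong, unfolded o_apply])
qed

text \<open>A path inside one level closes up to a cycle through the lowest common ancestor
  \<open>(par ^^ h) u = (par ^^ h) w\<close> of its ends.\<close>

lemma cycle_through_ancestor:
  assumes xs: "distinct xs" "xs \<noteq> []" "set xs \<subseteq> verts G" "\<And>x. x \<in> set xs \<Longrightarrow> lev x = t"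
    "successively (\<lambda>a b. {a, b} \<in> edges G) xs"
    and h: "1 \<le> h" "h \<le> t"
    and anc: "(par ^^ h) (hd xs) = (par ^^ h) (last xs)"
      "(par ^^ (h - 1)) (hd xs) \<noteq> (par ^^ (h - 1)) (last xs)"
  shows "contains_copy G (cycle_graph (length xs + 2 * h - 1))"
proof -
  let ?E = "\<lambda>a b. {a, b} \<in> edges G"
  define u where "u = hd xs"
  define w where "w = last xs"
  have uw: "u \<in> verts G" "w \<in> verts G" "lev u = t" "lev w = t"
    using xs by (auto simp: u_def w_def)
  \<comment> \<open>\<open>ys\<close> climbs from \<open>w\<close> up to and including the common
    ancestor. \<open>zs\<close> holds the ancestors of \<open>u\<close> strictly below it, so
    \<open>rev zs\<close> leads back down. Together they add \<open>h + (h - 1)\<close> vertices to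
    \<open>xs\<close>.\<close>
  define ys where "ys = map (\<lambda>j. (par ^^ j) w) [1..<Suc h]"
  define zs where "zs = map (\<lambda>j. (par ^^ j) u) [1..<h]"
  \<comment> \<open>The level of an ancestor determines how many steps up it lies, which gives
    injectivity on each line.\<close>
  have injw: "inj_on (\<lambda>j. (par ^^ j) w) {1..<Suc h}" and inju: "inj_on (\<lambda>j. (par ^^ j) u) {1..<h}"
    using par_pow(2) uw h by (auto intro!: inj_on_inverseI[of _ "\<lambda>x. t - lev x"])
  have "distinct ys" "distinct zs"
    unfolding ys_def zs_def distinct_map set_upt using injw inju by auto
  moreover have "set xs \<inter> set ys = {}" "set xs \<inter> set zs = {}"
  proof -
    have "lev y < t" if "y \<in> set ys \<union> set zs" for y
      using that h uw by (auto simp: ys_def zs_def par_pow(2))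
    then show "set xs \<inter> set ys = {}" "set xs \<inter> set zs = {}" using xs(4) by fastforce+
  qed
  moreover have "set ys \<inter> set zs = {}"
  proof -
    have "(par ^^ i) w \<noteq> (par ^^ j) u" if "1 \<le> i" "i \<le> h" "1 \<le> j" "j < h" for i j
    proof
      assume eq: "(par ^^ i) w = (par ^^ j) u"
      then have "t - i = t - j" using par_pow(2) uw that h by (metis le_trans less_imp_le)
      then have "i = j" using that h by simp
      moreover have "j \<le> h - 1" using that by simp
      ultimately show False using eq par_pow_neq[OF anc(2), of j] by (simp add: u_def w_def)
    qed
    then show ?thesis by (auto simp: ys_def zs_def)
  qed
  ultimately have dist: "distinct (xs @ ys @ rev zs)" using xs(1) by auto
  have len: "length (xs @ ys @ rev zs) = length xs + 2 * h - 1"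
    using h by (simp add: ys_def zs_def)
  have sub: "set (xs @ ys @ rev zs) \<subseteq> verts G"
    using xs(3) par_pow(1) uw h by (auto simp: ys_def zs_def)
  have edge: "?E ((par ^^ j) x) ((par ^^ Suc j) x)" "?E ((par ^^ Suc j) x) ((par ^^ j) x)"
    if "x \<in> {u, w}" "Suc j \<le> h" for x j
    using par_pow_edge[of x j] that uw h by (auto simp: insert_commute)
  have sy: "successively ?E ys"
    using edge[of w] by (auto simp: ys_def successively_conv_nth simp del: upt_Suc funpow.simps)
  have "successively (\<lambda>a b. ?E b a) zs"
    using edge[of u] by (auto simp: zs_def successively_conv_nth simp del: upt_Suc funpow.simps)
  then have sz: "successively ?E (rev zs)" by (simp only: successively_rev)
  have yne: "ys \<noteq> []" "hd ys = (par ^^ Suc 0) w" "last ys = (par ^^ h) u"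
    using h anc by (auto simp: ys_def hd_map last_map u_def w_def simp del: upt_Suc funpow.simps)
  have "successively ?E (xs @ ys @ rev zs) \<and> ?E (last (xs @ ys @ rev zs)) (hd (xs @ ys @ rev zs))"
  \<comment> \<open>For \<open>h = 1\<close> the descending part is empty: the common ancestor is
    the parent of both ends and closes the cycle by itself.\<close>
  proof (cases "h = 1")
    case True
    then have "zs = []" by (simp add: zs_def)
    moreover have "?E w (hd ys)" "?E (last ys) u"
      using edge[of w 0] edge[of u 0] yne h True by auto
    ultimately show ?thesis
      using xs sy yne by (auto simp: successively_append_iff u_def w_def)
  next
    case False
    then have z: "zs \<noteq> []" "hd zs = (par ^^ Suc 0) u" "last zs = (par ^^ (h - 1)) u"
      using h by (auto simp: zs_def hd_map last_map simp del: upt_Suc funpow.simps)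
    have "?E w (hd ys)" using edge[of w 0] yne h by auto
    moreover have "?E (last ys) (last zs)" using edge(2)[of u "h - 1"] yne z h by auto
    moreover have "?E (hd zs) u" using edge[of u 0] z h by auto
    ultimately show ?thesis
      using xs sy sz yne z
      by (auto simp: successively_append_iff u_def w_def hd_rev last_rev)
  qed
  then show ?thesis using contains_cycle_of_list[OF dist len sub] by blast
qed

end

section \<open>Edges inside a layer and odd cycles of prescribed length\<close>

lemma successively_const:
  "\<lbrakk>successively (\<lambda>a b. f a = f b) xs; x \<in> set xs\<rbrakk> \<Longrightarrow> f x = f (hd xs)"
  by (induction xs) (auto simp: successively_Cons)

lemma successively_alternating:
  "\<lbrakk>successively (\<lambda>a b. P a \<noteq> P b) xs; xs \<noteq> []\<rbrakk> \<Longrightarrow> P (last xs) \<longleftrightarrow> (P (hd xs) \<longleftrightarrow> odd (length xs))"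
  by (induction xs) (auto simp: successively_Cons)

context rooted_graph
begin

text \<open>The edges inside one layer whose ends have their lowest common ancestor exactly
  \<open>h\<close> steps up. The image cardinalities 1 and 2 express this without naming the
  ends.\<close>

definition meet_edges :: "nat \<Rightarrow> 'a set set" where
  "meet_edges h = {e \<in> edges G. (\<exists>t\<ge>h. \<forall>u\<in>e. lev u = t) \<and>
     card ((par ^^ h) ` e) = 1 \<and> card ((par ^^ (h - 1)) ` e) = 2}"

text \<open>Splitting the branches below the common ancestors into two classes makes the ends of an
  odd path lie in different branches.\<close>

lemma card_meet_edges_le:
  assumes "odd k" "2 * h < k" "1 \<le> h" "\<not> contains_copy G (cycle_graph k)"
  shows "card (meet_edges h) \<le> 2 * k * card (verts G)"
proof (rule ccontr)
  assume "\<not> ?thesis"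
  then have big: "card (meet_edges h) > 2 * k * card (verts G)" by simp
  have fin: "finite (verts G)" using simple by (simp add: simple_graph_def)
  have finM: "finite (meet_edges h)"
    using simple_graph_finite_edges[OF simple] by (simp add: meet_edges_def)
  let ?c = "par ^^ (h - 1)"
  have "\<exists>S\<subseteq>?c ` verts G. card (meet_edges h) \<le> 2 * card {e \<in> meet_edges h. card (?c ` e \<inter> S) = 1}"
    using fin finM simple
    by (intro exists_splitting_set) (auto simp: meet_edges_def simple_graph_def)
  then obtain S where S: "card (meet_edges h) \<le> 2 * card {e \<in> meet_edges h. card (?c ` e \<inter> S) = 1}"
    by blast
  define Q where "Q = {e \<in> meet_edges h. card (?c ` e \<inter> S) = 1}"
  \<comment> \<open>A path with \<open>l\<close> edges and the \<open>2 * h\<close> tree edges above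
    its ends form a cycle of length \<open>k\<close>. As \<open>k\<close> is odd, so is
    \<open>l\<close>, and a path alternating between \<open>S\<close> and its complement then has
    its ends on different sides.\<close>
  define l where "l = k - 2 * h"
  have l: "odd l" "l \<ge> 1" "l \<le> k" using assms by (auto simp: l_def)
  \<comment> \<open>The factor 2 in the bound pays for the edges not split by \<open>S\<close>; the
    factor \<open>k\<close> leaves room for every \<open>l \<le> k\<close>.\<close>
  have "2 * (k * card (verts G)) < 2 * card Q" using S big by (simp add: Q_def)
  moreover have "l * card (verts G) \<le> k * card (verts G)" using l by simp
  ultimately have "card Q > l * card (verts G)" by linarith
  moreover have "e \<subseteq> verts G \<and> card e = 2" if "e \<in> Q" for e
    using that simple by (auto simp: Q_def meet_edges_def simple_graph_def)
  ultimately obtain xs where xs: "distinct xs" "length xs = Suc l" "set xs \<subseteq> verts G"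
      "successively (\<lambda>a b. {a, b} \<in> Q) xs"
    using many_edges_imp_path[OF fin, of Q l] by blast
  have Q: "{a, b} \<in> edges G" "lev a = lev b" "h \<le> lev a" "(par ^^ h) a = (par ^^ h) b"
      "(?c a \<in> S) \<noteq> (?c b \<in> S)" if "{a, b} \<in> Q" for a b
  proof -
    have *: "{a, b} \<in> edges G" "\<exists>t\<ge>h. \<forall>u\<in>{a, b}. lev u = t" "card ((par ^^ h) ` {a, b}) = 1"
      "card (?c ` {a, b}) = 2" "card (?c ` {a, b} \<inter> S) = 1"
      using that unfolding Q_def meet_edges_def by blast+
    then show "{a, b} \<in> edges G" "lev a = lev b" "h \<le> lev a" by auto
    show "(par ^^ h) a = (par ^^ h) b" using *(3) by (auto simp: card_1_singleton_iff)
    have "?c a \<noteq> ?c b" using *(4) by auto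
    then show "(?c a \<in> S) \<noteq> (?c b \<in> S)" using *(5) by (auto simp: Int_insert_left split: if_splits)
  qed
  have ne: "xs \<noteq> []" using xs by auto
  have "successively (\<lambda>a b. (?c a \<in> S) \<noteq> (?c b \<in> S)) xs"
    using xs(4) Q(5) by (rule successively_mono)
  from successively_alternating[OF this ne] have diff: "?c (hd xs) \<noteq> ?c (last xs)"
    using l xs(2) by auto
  \<comment> \<open>Level and ancestor at height \<open>h\<close> agree across each edge of
    \<open>Q\<close>, hence are constant along the whole path.\<close>
  have "successively (\<lambda>a b. lev a = lev b) xs"
    using xs(4) Q(2) by (rule successively_mono)
  then have lev: "lev x = lev (hd xs)" if "x \<in> set xs" for x
    using that by (rule successively_const)
  have "successively (\<lambda>a b. (par ^^ h) a = (par ^^ h) b) xs"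
    using xs(4) Q(4) by (rule successively_mono)
  then have eq: "(par ^^ h) (hd xs) = (par ^^ h) (last xs)"
    using successively_const[of "par ^^ h" xs "last xs"] ne by simp
  have adj: "successively (\<lambda>a b. {a, b} \<in> edges G) xs"
    using xs(4) Q(1) by (rule successively_mono)
  obtain a b ys where "xs = a # b # ys" using xs(2) l by (cases xs; cases "tl xs") auto
  then have "h \<le> lev (hd xs)" using xs(4) Q(3) by auto
  from cycle_through_ancestor[OF xs(1) ne xs(3) lev adj assms(3) this eq diff]
  have "contains_copy G (cycle_graph (length xs + 2 * h - 1))" .
  moreover have "length xs + 2 * h - 1 = k" using xs(2) assms by (simp add: l_def)
  ultimately show False using assms by simp
qed

text \<open>Both ends reach the root after as many steps as their common level, so a least number
  \<open>h\<close> of steps makes their ancestors agree. It is positive because the ends differ, and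
  at most \<open>R\<close> because levels are.\<close>

lemma level_edge_imp_meet_edge:
  assumes "e \<in> edges G" "\<And>u w. \<lbrakk>u \<in> e; w \<in> e\<rbrakk> \<Longrightarrow> lev u = lev w"
  shows "\<exists>h\<in>{1..R}. e \<in> meet_edges h"
proof -
  obtain u w where e: "e = {u, w}" "u \<noteq> w"
    using assms(1) simple by (auto simp: simple_graph_def card_2_iff)
  have uw: "u \<in> verts G" "w \<in> verts G" "lev u = lev w"
    using simple_graph_edgeD[OF simple] assms e by auto
  define t where "t = lev u"
  have "(par ^^ t) u = v" "(par ^^ t) w = v"
    using par_pow[of u t] par_pow[of w t] uw lev_eq_0 by (auto simp: t_def)
  then have t: "(par ^^ t) u = (par ^^ t) w" by simp
  define h where "h = (LEAST j. (par ^^ j) u = (par ^^ j) w)"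
  have h: "(par ^^ h) u = (par ^^ h) w" unfolding h_def using t by (rule LeastI)
  have "h \<le> t" unfolding h_def using t by (rule Least_le)
  have "h \<noteq> 0" using h e by (metis funpow_0)
  then have "(par ^^ (h - 1)) u \<noteq> (par ^^ (h - 1)) w"
    using not_less_Least[of "h - 1" "\<lambda>j. (par ^^ j) u = (par ^^ j) w"] by (auto simp: h_def)
  then have "e \<in> meet_edges h"
    using h assms(1) uw \<open>h \<le> t\<close> by (auto simp: meet_edges_def e t_def)
  moreover have "h \<in> {1..R}" using \<open>h \<noteq> 0\<close> \<open>h \<le> t\<close> lev_le[OF uw(1)] by (auto simp: t_def)
  ultimately show ?thesis by blast
qed

text \<open>Adjacent levels differ by at most one, so an edge not inside a layer changes the parity
  of the level. The edges inside layers are covered by \<open>meet_edges h\<close> for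
  \<open>h\<close> from 1 to \<open>R\<close>, and \<open>2 * R < k\<close> makes the bound on each
  of these sets available.\<close>

lemma large_bipartite_subgraph:
  assumes "odd k" "2 * R < k" "\<not> contains_copy G (cycle_graph k)"
  shows "\<exists>H. is_subgraph H G \<and> bipartite H \<and> verts H = verts G \<and>
    card (edges G) \<le> card (edges H) + R * (2 * k * card (verts G))"
proof -
  define bad where "bad = {e \<in> edges G. \<forall>u\<in>e. \<forall>w\<in>e. lev u = lev w}"
  let ?H = "(verts G, edges G - bad)"
  have finE: "finite (edges G)" using simple by (rule simple_graph_finite_edges)
  have "bad \<subseteq> (\<Union>h\<in>{1..R}. meet_edges h)"
    using level_edge_imp_meet_edge unfolding bad_def by blast
  moreover have "finite (\<Union>h\<in>{1..R}. meet_edges h)"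
    using finE by (auto simp: meet_edges_def)
  ultimately have "card bad \<le> card (\<Union>h\<in>{1..R}. meet_edges h)" by (rule card_mono[rotated])
  also have "\<dots> \<le> (\<Sum>h\<in>{1..R}. card (meet_edges h))" by (rule card_UN_le) simp
  also have "\<dots> \<le> (\<Sum>h\<in>{1..R}. 2 * k * card (verts G))"
    using assms by (intro sum_mono card_meet_edges_le) auto
  finally have "card bad \<le> R * (2 * k * card (verts G))" by simp
  moreover have "card (edges G) \<le> card (edges G - bad) + card bad"
    using finE card_Diff_subset[of bad "edges G"] by (simp add: bad_def)
  moreover have "bipartition ?H {u \<in> verts G. even (lev u)} {u \<in> verts G. odd (lev u)}"
  proof -
    have "\<exists>a\<in>{u \<in> verts G. even (lev u)}. \<exists>b\<in>{u \<in> verts G. odd (lev u)}. e = {a, b}"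
      if e: "e \<in> edges G - bad" for e
    proof -
      obtain u w where e': "e = {u, w}"
        using e simple by (auto simp: simple_graph_def card_2_iff)
      then have uw: "u \<in> verts G" "w \<in> verts G" using simple_graph_edgeD[OF simple] e by auto
      have "lev u \<noteq> lev w" using e e' by (auto simp: bad_def)
      moreover have "lev w \<le> Suc (lev u)" "lev u \<le> Suc (lev w)"
        using lev_adj_le[of u w] lev_adj_le[of w u] e e' by (auto simp: insert_commute)
      ultimately have "lev u = Suc (lev w) \<or> lev w = Suc (lev u)" by linarith
      then have "even (lev u) \<and> odd (lev w) \<or> even (lev w) \<and> odd (lev u)" by auto
      then show ?thesis using uw e' by (auto simp: insert_commute)
    qed
    then show ?thesis by (auto simp: bipartition_def)
  qed
  moreover have "is_subgraph ?H G" using simple by (auto simp: is_subgraph_def simple_graph_def)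
  ultimately show ?thesis by (intro exI[of _ ?H]) (auto simp: bipartite_def)
qed

end

section \<open>Densest subgraphs and expansion\<close>

lemma cut_commute: "cut G X Y = cut G Y X"
  unfolding cut_def by (metis insert_commute)

lemma card_cut_le_mult:
  assumes "finite X" "finite Y" shows "card (cut G X Y) \<le> card X * card Y"
proof -
  have "cut G X Y \<subseteq> (\<lambda>(x, y). {x, y}) ` (X \<times> Y)" by (auto simp: cut_def)
  then have "card (cut G X Y) \<le> card (X \<times> Y)"
    using assms by (meson card_image_le card_mono finite_SigmaI finite_imageI order_trans)
  then show ?thesis by (simp add: card_cartesian_product)
qed

lemma card_edges_induced_split:
  assumes "simple_graph G" "Y \<subseteq> X"
  shows "card (edges (induced G X)) = card (edges (induced G Y)) + card (edges (induced G (X - Y)))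
     + card (cut (induced G X) Y (X - Y))"
proof -
  have fin: "finite (edges G)" using assms(1) by (rule simple_graph_finite_edges)
  have sz: "card e = 2" if "e \<in> edges G" for e using assms(1) that by (auto simp: simple_graph_def)
  let ?A = "edges (induced G Y)" and ?B = "edges (induced G (X - Y))" and ?C = "cut (induced G X) Y (X - Y)"
  have "edges (induced G X) = (?A \<union> ?B) \<union> ?C"
  proof
    show "edges (induced G X) \<subseteq> (?A \<union> ?B) \<union> ?C"
    proof
      fix e assume e: "e \<in> edges (induced G X)"
      then have "card e = 2" using sz by (simp add: induced_def)
      then obtain a b where "e = {a, b}" by (auto simp: card_2_iff)
      then show "e \<in> (?A \<union> ?B) \<union> ?C"
        using e by (cases "a \<in> Y"; cases "b \<in> Y") (auto simp: induced_def cut_def insert_commute)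
    qed
    show "(?A \<union> ?B) \<union> ?C \<subseteq> edges (induced G X)"
      using assms(2) by (auto simp: induced_def cut_def)
  qed
  moreover have "?A \<inter> ?B = {}"
  proof -
    have False if e: "e \<in> ?A" "e \<in> ?B" for e
    proof -
      have "e = {}" using e by (auto simp: induced_def)
      then show False using e sz[of e] by (simp add: induced_def)
    qed
    then show ?thesis by blast
  qed
  moreover have "(?A \<union> ?B) \<inter> ?C = {}"
    by (auto simp: induced_def cut_def)
  moreover have "finite ?A" "finite ?B" "finite ?C" using fin by (auto simp: induced_def cut_def)
  ultimately show ?thesis by (simp add: card_Un_disjoint)
qed

section \<open>Superadditivity of powers and the densest induced subgraph\<close>

lemma powr_le_powr_imp_le:
  fixes x y p :: real
  assumes "x powr p \<le> y powr p" "0 < p" "0 \<le> y" shows "x \<le> y"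
  using assms powr_less_mono2[of p y x] by linarith

text \<open>Write \<open>t powr \<gamma>\<close> as \<open>t * t powr (\<gamma> - 1)\<close>. The
  part \<open>x\<close>, at most half of \<open>n\<close>, saves the factor
  \<open>2 powr (1 - \<gamma>)\<close> in its second factor; for the part \<open>n - x\<close>
  monotonicity is enough.\<close>

lemma powr_superadditive:
  fixes n x \<gamma> :: real
  assumes "1 < \<gamma>" "0 < x" "2 * x \<le> n"
  shows "(1 - 2 powr (1 - \<gamma>)) * n powr (\<gamma> - 1) * x \<le> n powr \<gamma> - x powr \<gamma> - (n - x) powr \<gamma>"
proof -
  have split: "y powr \<gamma> = y * y powr (\<gamma> - 1)" if "y > 0" for y :: real
    using that by (simp add: powr_mult_base)
  have "x powr (\<gamma> - 1) \<le> (n / 2) powr (\<gamma> - 1)"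
    using assms by (intro powr_mono2) auto
  also have "\<dots> = n powr (\<gamma> - 1) * 2 powr (1 - \<gamma>)"
    using assms by (simp add: powr_divide powr_diff)
  finally have "x powr \<gamma> \<le> x * (n powr (\<gamma> - 1) * 2 powr (1 - \<gamma>))"
    using assms by (simp add: split mult_left_mono)
  moreover have "(n - x) powr (\<gamma> - 1) \<le> n powr (\<gamma> - 1)"
    using assms by (intro powr_mono2) auto
  then have "(n - x) powr \<gamma> \<le> (n - x) * n powr (\<gamma> - 1)"
    using assms by (simp add: split mult_left_mono)
  moreover have "n powr \<gamma> = n * n powr (\<gamma> - 1)" using assms by (intro split) auto
  ultimately show ?thesis by (simp add: algebra_simps)
qed

text \<open>Maximising \<open>e(X) / |X| powr \<gamma>\<close> forces every cut of \<open>X\<close> to carry many edges, since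
  \<open>t powr \<gamma>\<close> is strictly superadditive.\<close>

lemma densest_induced_subgraph_expands:
  fixes \<gamma> :: real
  assumes G: "simple_graph G" "edges G \<noteq> {}" and \<gamma>: "1 < \<gamma>"
  obtains X where "X \<subseteq> verts G" "X \<noteq> {}"
    "card (edges G) / card (verts G) powr \<gamma> \<le> card (edges (induced G X)) / card X powr \<gamma>"
    "\<And>Y. \<lbrakk>Y \<subseteq> X; Y \<noteq> {}; 2 * card Y \<le> card X\<rbrakk> \<Longrightarrow>
      (1 - 2 powr (1 - \<gamma>)) * (card (edges (induced G X)) / card X) * card Y
        \<le> card (cut (induced G X) Y (X - Y))"
proof -
  define f where "f X = card (edges (induced G X)) / card X powr \<gamma>" for X
  have fin: "finite (verts G)" using G by (simp add: simple_graph_def)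
  have VG: "verts G \<noteq> {}" using G by (fastforce simp: simple_graph_def)
  let ?S = "f ` (Pow (verts G) - {{}})"
  have S: "finite ?S" "?S \<noteq> {}" using fin VG by auto
  obtain X where "X \<in> Pow (verts G) - {{}}" "Max ?S = f X"
    using Max_in[OF S] by (rule imageE)
  then have X: "X \<subseteq> verts G" "X \<noteq> {}" "f X = Max ?S" by auto
  have max: "f Y \<le> f X" if "Y \<subseteq> verts G" "Y \<noteq> {}" for Y
    unfolding X(3) using S that by (intro Max_ge) auto
  show ?thesis
  proof (rule that[OF X(1,2)])
    have "edges (induced G (verts G)) = edges G" using G by (auto simp: induced_def simple_graph_def)
    then show "card (edges G) / card (verts G) powr \<gamma> \<le> card (edges (induced G X)) / card X powr \<gamma>"
      using max[of "verts G"] VG by (simp add: f_def)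
    fix Y assume Y: "Y \<subseteq> X" "Y \<noteq> {}" "2 * card Y \<le> card X"
    have finX: "finite X" using X fin finite_subset by blast
    have pos: "card Y > 0" "card X > 0" using Y X finX finite_subset by (auto simp: card_gt_0_iff)
    have cd: "card (X - Y) = card X - card Y"
      using Y finX by (meson card_Diff_subset finite_subset)
    have "X - Y \<noteq> {}" using cd pos Y by fastforce
    \<comment> \<open>Maximality bounds the edges inside \<open>Y\<close> and inside
      \<open>X - Y\<close>; by superadditivity these cannot account for all edges of
      \<open>X\<close>, and the rest cross the cut.\<close>
    have le: "card (edges (induced G Z)) \<le> f X * card Z powr \<gamma>" if "Z \<subseteq> X" "Z \<noteq> {}" for Z
    proof -
      have "card Z > 0" using that finX finite_subset by (auto simp: card_gt_0_iff)
      then show ?thesis using max[of Z] that X(1) by (simp add: f_def field_simps)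
    qed
    define x n where "x = real (card Y)" and "n = real (card X)"
    have xn: "x > 0" "2 * x \<le> n" "n > 0" using pos Y by (auto simp: x_def n_def)
    have f0: "f X \<ge> 0" by (simp add: f_def)
    have rcd: "real (card (X - Y)) = n - x" using cd Y pos by (simp add: x_def n_def of_nat_diff)
    have eX: "real (card (edges (induced G X))) = f X * n powr \<gamma>" using xn by (simp add: f_def n_def)
    have "(1 - 2 powr (1 - \<gamma>)) * (card (edges (induced G X)) / card X) * card Y
       = f X * ((1 - 2 powr (1 - \<gamma>)) * n powr (\<gamma> - 1) * x)"
      unfolding eX using xn by (simp add: powr_diff x_def n_def)
    also have "\<dots> \<le> f X * (n powr \<gamma> - x powr \<gamma> - (n - x) powr \<gamma>)"
      using powr_superadditive[OF \<gamma> xn(1,2)] f0 by (intro mult_left_mono) auto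
    also have "\<dots> = real (card (edges (induced G X))) - f X * x powr \<gamma> - f X * (n - x) powr \<gamma>"
      by (simp add: eX algebra_simps)
    also have "\<dots> \<le> real (card (edges (induced G X))) - card (edges (induced G Y)) - card (edges (induced G (X - Y)))"
      using le[of Y] le[of "X - Y"] Y \<open>X - Y \<noteq> {}\<close> rcd by (simp add: x_def)
    also have "\<dots> = card (cut (induced G X) Y (X - Y))"
      using card_edges_induced_split[OF G(1) Y(1)] by simp
    finally show "(1 - 2 powr (1 - \<gamma>)) * (card (edges (induced G X)) / card X) * card Y
        \<le> card (cut (induced G X) Y (X - Y))" .
  qed
qed

text \<open>Here \<open>n\<close> is the order of the graph, \<open>x\<close> the size of a ball and
  \<open>w\<close> the number of vertices reached next; \<open>E\<close> sets the edges forced out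
  by expansion against the most that smoothness allows. One of the two terms on the right is at
  least half of the left side. If it is the main term, \<open>w\<close> is linear in
  \<open>n\<close>; if it is the error term, \<open>w\<close> exceeds \<open>x\<close> by a power of
  \<open>n\<close>.\<close>

lemma growth_dichotomy:
  fixes n x w \<alpha> \<beta> \<rho> C c :: real
  assumes par: "1 \<le> \<beta>" "\<beta> < \<alpha>" "\<rho> > 0" "C > 0" "c > 0"
    and x: "1 \<le> x" "x \<le> n" and w: "0 < w" "w \<le> n"
    and n: "2 * C / c < n powr ((\<alpha> - \<beta>) / 2)"
    and E: "c * n powr (\<alpha> - 1) * x \<le> \<rho> * min x w * max x w powr (\<alpha> - 1) + C * max x w powr \<beta>"
  defines "\<kappa> \<equiv> c / (2 * \<rho>)"
  shows "min 1 \<kappa> * \<kappa> powr (1 / (\<alpha> - 1)) * n \<le> w \<or> n powr ((\<alpha> - \<beta>) / (2 * \<beta>)) * x \<le> w"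
proof -
  have n1: "n \<ge> 1" using x by simp
  have \<kappa>: "\<kappa> > 0" using par by (simp add: \<kappa>_def)
  define c2 where "c2 = \<kappa> powr (1 / (\<alpha> - 1))"
  have c2: "c2 > 0" using \<kappa> by (simp add: c2_def)
  consider (dense) "c / 2 * n powr (\<alpha> - 1) * x \<le> \<rho> * min x w * max x w powr (\<alpha> - 1)"
    | (sparse) "c / 2 * n powr (\<alpha> - 1) * x \<le> C * max x w powr \<beta>"
    using E by (cases "c / 2 * n powr (\<alpha> - 1) * x \<le> \<rho> * min x w * max x w powr (\<alpha> - 1)") (auto simp: algebra_simps)
  then show ?thesis
  proof cases
    case dense
    have "\<rho> * min x w * max x w powr (\<alpha> - 1) \<le> \<rho> * x * max x w powr (\<alpha> - 1)"
      using par by (intro mult_right_mono mult_left_mono) auto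
    with dense have "c / 2 * n powr (\<alpha> - 1) * x \<le> (\<rho> * max x w powr (\<alpha> - 1)) * x" by (simp add: mult_ac)
    then have "c / 2 * n powr (\<alpha> - 1) \<le> \<rho> * max x w powr (\<alpha> - 1)" using x by simp
    then have "\<kappa> * n powr (\<alpha> - 1) \<le> max x w powr (\<alpha> - 1)"
      using par by (simp add: \<kappa>_def field_simps)
    moreover have "\<kappa> = c2 powr (\<alpha> - 1)" using par \<kappa> by (simp add: c2_def powr_powr)
    ultimately have "(c2 * n) powr (\<alpha> - 1) \<le> max x w powr (\<alpha> - 1)"
      using c2 n1 by (simp add: powr_mult)
    then have mx: "c2 * n \<le> max x w"
      using par x by (elim powr_le_powr_imp_le) auto
    have c2n: "c2 * n > 0" using c2 n1 by simp
    \<comment> \<open>If \<open>w\<close> is the larger size, it is at least \<open>c2 * n\<close>.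
      Otherwise \<open>x\<close> is, and cancelling powers in the main term gives
      \<open>w \<ge> \<kappa> * x\<close>.\<close>
    have "min 1 \<kappa> * (c2 * n) \<le> w"
    proof (cases "x \<le> w")
      case True
      have "min 1 \<kappa> * (c2 * n) \<le> 1 * (c2 * n)" using c2n by (intro mult_right_mono) auto
      then show ?thesis using mx True by simp
    next
      case False
      have "c / 2 * n powr (\<alpha> - 1) * x \<le> \<rho> * w * x powr (\<alpha> - 1)" using dense False by simp
      also have "\<dots> \<le> \<rho> * w * n powr (\<alpha> - 1)"
        using par x w by (intro mult_left_mono powr_mono2) auto
      finally have "(c / 2 * x) * n powr (\<alpha> - 1) \<le> (\<rho> * w) * n powr (\<alpha> - 1)" by (simp add: mult_ac)
      then have "c / 2 * x \<le> \<rho> * w" using n1 by simp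
      then have "\<kappa> * x \<le> w" using par by (simp add: \<kappa>_def field_simps)
      moreover have "\<kappa> * (c2 * n) \<le> \<kappa> * x" using mx False \<kappa> by simp
      moreover have "min 1 \<kappa> * (c2 * n) \<le> \<kappa> * (c2 * n)" using c2n by (intro mult_right_mono) auto
      ultimately show ?thesis by linarith
    qed
    then show ?thesis by (simp add: c2_def mult.assoc)
  next
    case sparse
    show ?thesis
    proof (cases "x \<le> w")
      case True
      \<comment> \<open>From \<open>x \<le> n\<close> and \<open>\<beta> \<ge> 1\<close>, the left
        side is at least \<open>n powr (\<alpha> - \<beta>) * x powr \<beta>\<close> up to the
        constant. Half of the exponent \<open>\<alpha> - \<beta>\<close> absorbs
        \<open>2 * C / c\<close>; the other half, after taking roots of order
        \<open>\<beta>\<close>, is the growth factor.\<close>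
      have "n powr (1 - \<beta>) \<le> x powr (1 - \<beta>)"
        using x par by (intro powr_mono2') auto
      then have "n powr (1 - \<beta>) * x powr \<beta> \<le> x powr (1 - \<beta>) * x powr \<beta>"
        by (intro mult_right_mono) auto
      also have "\<dots> = x" using x by (simp add: powr_add[symmetric])
      finally have "n powr (\<alpha> - 1) * (n powr (1 - \<beta>) * x powr \<beta>) \<le> n powr (\<alpha> - 1) * x"
        by (intro mult_left_mono) auto
      then have a: "n powr (\<alpha> - \<beta>) * x powr \<beta> \<le> n powr (\<alpha> - 1) * x"
        using n1 by (simp add: mult.assoc[symmetric] powr_add[symmetric])
      have "c / 2 * n powr (\<alpha> - 1) * x \<le> C * w powr \<beta>" using sparse True by (simp add: max_def)
      then have "n powr (\<alpha> - 1) * x \<le> (2 * C / c) * w powr \<beta>" using par by (simp add: field_simps)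
      also have "\<dots> \<le> n powr ((\<alpha> - \<beta>) / 2) * w powr \<beta>" using n by (intro mult_right_mono) auto
      finally have "n powr (\<alpha> - \<beta>) * x powr \<beta> \<le> n powr ((\<alpha> - \<beta>) / 2) * w powr \<beta>" using a by linarith
      moreover have "n powr (\<alpha> - \<beta>) = n powr ((\<alpha> - \<beta>) / 2) * n powr ((\<alpha> - \<beta>) / 2)"
        by (simp add: powr_add[symmetric])
      ultimately have "n powr ((\<alpha> - \<beta>) / 2) * x powr \<beta> \<le> w powr \<beta>" using n1 by (simp add: mult.assoc)
      moreover have "n powr ((\<alpha> - \<beta>) / 2) = (n powr ((\<alpha> - \<beta>) / (2 * \<beta>))) powr \<beta>"
        using par by (simp add: powr_powr)
      ultimately have "(n powr ((\<alpha> - \<beta>) / (2 * \<beta>)) * x) powr \<beta> \<le> w powr \<beta>"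
        using x by (simp add: powr_mult)
      then have "n powr ((\<alpha> - \<beta>) / (2 * \<beta>)) * x \<le> w"
        using par w by (elim powr_le_powr_imp_le) auto
      then show ?thesis ..
    next
      case False
      \<comment> \<open>With \<open>w < x\<close> the error term is too small: the inequality would
        force \<open>n powr (\<alpha> - \<beta>) \<le> 2 * C / c\<close>, against the largeness of
        \<open>n\<close>.\<close>
      have "x powr \<beta> = x powr (\<beta> - 1) * x" using x by (simp add: powr_diff)
      also have "\<dots> \<le> n powr (\<beta> - 1) * x" using x par by (intro mult_right_mono powr_mono2) auto
      finally have "C * x powr \<beta> \<le> C * (n powr (\<beta> - 1) * x)" using par by simp
      then have "c / 2 * n powr (\<alpha> - 1) * x \<le> (C * n powr (\<beta> - 1)) * x" using sparse False by (simp add: max_def mult_ac)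
      then have "c / 2 * n powr (\<alpha> - 1) \<le> C * n powr (\<beta> - 1)" using x by simp
      moreover have "n powr (\<alpha> - 1) = n powr (\<alpha> - \<beta>) * n powr (\<beta> - 1)" by (simp add: powr_add[symmetric])
      ultimately have "(c / 2 * n powr (\<alpha> - \<beta>)) * n powr (\<beta> - 1) \<le> C * n powr (\<beta> - 1)" by (simp add: mult.assoc)
      then have "c / 2 * n powr (\<alpha> - \<beta>) \<le> C" using n1 by simp
      then have "n powr (\<alpha> - \<beta>) \<le> 2 * C / c" using par by (simp add: field_simps)
      moreover have "n powr ((\<alpha> - \<beta>) / 2) \<le> n powr (\<alpha> - \<beta>)" using n1 par by (intro powr_mono) auto
      ultimately show ?thesis using n by linarith
    qed
  qed
qed

section \<open>Smooth families\<close>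

text \<open>Smoothness with its constants fixed. Positivity of \<open>C\<close> is no loss, as the
  error constant may be increased.\<close>

locale smooth_family =
  fixes \<F> :: "nat graph set" and \<alpha> \<beta> \<rho> C :: real and N :: nat
  assumes par: "1 \<le> \<beta>" "\<beta> < \<alpha>" "\<alpha> < 2" "\<rho> > 0" "C > 0"
    and smooth: "\<And>m n. \<lbrakk>N \<le> n; m \<le> n\<rbrakk> \<Longrightarrow>
      \<bar>real (zarankiewicz m n \<F>) - \<rho> * real m * real n powr (\<alpha> - 1)\<bar> \<le> C * real n powr \<beta>"
begin

lemma zarankiewicz_le:
  "\<lbrakk>N \<le> n; m \<le> n\<rbrakk> \<Longrightarrow> zarankiewicz m n \<F> \<le> \<rho> * m * n powr (\<alpha> - 1) + C * n powr \<beta>"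
  using smooth[of n m] by linarith

text \<open>Smoothness speaks of the smaller size first and needs only the larger one to reach
  \<open>N\<close>; \<open>min\<close> and \<open>max\<close> make the bound usable without knowing
  which side is larger.\<close>

lemma card_cut_le:
  fixes G :: "nat graph"
  assumes "simple_graph G" "graph_free \<F> G" "X \<subseteq> verts G" "Y \<subseteq> verts G" "X \<inter> Y = {}"
    "N \<le> max (card X) (card Y)"
  shows "card (cut G X Y) \<le> \<rho> * min (real (card X)) (card Y) * max (real (card X)) (card Y) powr (\<alpha> - 1)
    + C * max (real (card X)) (card Y) powr \<beta>"
proof (cases "card X \<le> card Y")
  case True
  then have "real (card (cut G X Y)) \<le> zarankiewicz (card X) (card Y) \<F>"
    using card_cut_le_zarankiewicz assms(1-5) by (simp only: of_nat_le_iff)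
  then show ?thesis using zarankiewicz_le[of "card Y" "card X"] True assms(6) by (simp add: max_def min_def)
next
  case False
  then have "real (card (cut G X Y)) \<le> zarankiewicz (card Y) (card X) \<F>"
    unfolding cut_commute[of G X] using card_cut_le_zarankiewicz[of G \<F> Y X] assms(1-5)
    by (simp only: of_nat_le_iff Int_commute)
  then show ?thesis using zarankiewicz_le[of "card X" "card Y"] False assms(6) by (simp add: max_def min_def)
qed

section \<open>Growth of balls in expanding graphs\<close>

definition linear_gain :: "real \<Rightarrow> real" where
  "linear_gain c = min 1 (c / (2 * \<rho>)) * (c / (2 * \<rho>)) powr (1 / (\<alpha> - 1))"

lemma linear_gain_pos: "c > 0 \<Longrightarrow> linear_gain c > 0"
  using par by (simp add: linear_gain_def)

definition expanding :: "real \<Rightarrow> nat graph \<Rightarrow> bool" where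
  "expanding c G \<longleftrightarrow> simple_graph G \<and> graph_free \<F> G \<and>
     (\<forall>X\<subseteq>verts G. X \<noteq> {} \<longrightarrow> 2 * card X \<le> card (verts G) \<longrightarrow>
        c * card (verts G) powr (\<alpha> - 1) * card X \<le> card (cut G X (verts G - X)))"

text \<open>The first condition makes the vertices next to a ball numerous enough for the smoothness
  bound; the second lets a power of \<open>n\<close> absorb the error constant in
  \<open>growth_dichotomy\<close>.\<close>

definition large_order :: "real \<Rightarrow> real \<Rightarrow> bool" where
  "large_order c n \<longleftrightarrow> real N \<le> c * n powr (\<alpha> - 1) \<and> 2 * C / c < n powr ((\<alpha> - \<beta>) / 2)"

text \<open>Every edge leaving the ball ends in the set \<open>W\<close> of newly reached vertices.
  Expansion bounds these edges from below, smoothness from above, and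
  \<open>growth_dichotomy\<close> compares the two.\<close>

lemma ball_growth:
  assumes G: "expanding c G" and c: "c > 0" and u: "u \<in> verts G"
    and large: "large_order c (card (verts G))"
    and half: "2 * card (ball G u i) \<le> card (verts G)"
  shows "card (ball G u (Suc i)) \<ge> card (ball G u i) + linear_gain c * card (verts G) \<or>
    card (ball G u (Suc i)) \<ge> card (verts G) powr ((\<alpha> - \<beta>) / (2 * \<beta>)) * card (ball G u i)"
proof -
  define V where "V = verts G"
  define X where "X = ball G u i"
  define W where "W = ball G u (Suc i) - X"
  have simple: "simple_graph G" and free: "graph_free \<F> G" using G by (auto simp: expanding_def)
  have sub: "X \<subseteq> V" "ball G u (Suc i) \<subseteq> V"
    unfolding V_def X_def using ball_subset_verts simple u by metis+
  have fin: "finite V" using simple by (simp add: V_def simple_graph_def)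
  then have finX: "finite X" "finite W" "finite (ball G u (Suc i))"
    using sub finite_subset by (auto simp: W_def)
  have WV: "W \<subseteq> V" "X \<inter> W = {}" using sub by (auto simp: W_def)
  have "u \<in> X" using ball_mono[of 0 i G u] by (auto simp: X_def)
  then have x1: "card X \<ge> 1" using finX by (metis One_nat_def Suc_leI card_gt_0_iff empty_iff)
  have "cut G X (V - X) = cut G X W"
  proof -
    have "y \<in> W" if "{x, y} \<in> edges G" "x \<in> X" "y \<notin> X" for x y
      using that unfolding W_def X_def ball.simps by blast
    then show ?thesis using WV unfolding cut_def by blast
  qed
  then have ex: "c * card V powr (\<alpha> - 1) * card X \<le> card (cut G X W)"
    using G half sub(1) \<open>u \<in> X\<close> unfolding expanding_def V_def[symmetric] X_def[symmetric]
    by (metis empty_iff)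
  \<comment> \<open>The trivial bound on the cut already gives
    \<open>card W \<ge> c * card V powr (\<alpha> - 1)\<close>, hence at least \<open>N\<close>, so
    that the smoothness bound applies.\<close>
  have "real (card (cut G X W)) \<le> card X * card W"
    using card_cut_le_mult finX by (metis of_nat_le_iff of_nat_mult)
  have cards: "card X \<le> card V" "card W \<le> card V"
    using sub(1) WV fin by (auto intro: card_mono)
  have "c * card V powr (\<alpha> - 1) * card X \<le> real (card W) * card X"
    using ex \<open>real (card (cut G X W)) \<le> card X * card W\<close> by (simp add: mult.commute)
  then have wl: "c * card V powr (\<alpha> - 1) \<le> card W" using x1 by simp
  moreover have "c * card V powr (\<alpha> - 1) > 0" using c x1 cards(1) by simp
  ultimately have w0: "real (card W) > 0" by linarith
  have wN: "N \<le> max (card X) (card W)"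
    using wl large by (simp add: large_order_def V_def max_def)
  have "c * card V powr (\<alpha> - 1) * card X \<le>
     \<rho> * min (real (card X)) (card W) * max (real (card X)) (card W) powr (\<alpha> - 1)
       + C * max (real (card X)) (card W) powr \<beta>"
    using ex card_cut_le[of G X W] simple free sub(1) WV wN unfolding V_def by linarith
  then have "linear_gain c * card V \<le> card W \<or> card V powr ((\<alpha> - \<beta>) / (2 * \<beta>)) * card X \<le> card W"
    unfolding linear_gain_def
    using growth_dichotomy[of \<beta> \<alpha> \<rho> C c "card X" "card V" "card W"] par c x1 cards w0 large
    by (simp add: large_order_def V_def)
  moreover have "card (ball G u (Suc i)) = card X + card W"
  proof -
    have "ball G u (Suc i) = X \<union> W" by (auto simp: W_def X_def)
    then show ?thesis using finX WV by (simp add: card_Un_disjoint)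
  qed
  ultimately show ?thesis by (auto simp: V_def X_def)
qed

text \<open>While a ball has at most half of the vertices, each step either gains a fixed share of
  \<open>n\<close> or multiplies the size by \<open>n powr \<zeta>\<close>. After
  \<open>P + Q\<close> steps there are \<open>P\<close> of the first kind or at least
  \<open>Q\<close> of the second, and either would bring the ball to size \<open>n\<close>. Neither
  \<open>P\<close> nor \<open>Q\<close> depends on the graph.\<close>

lemma ball_exceeds_half:
  assumes G: "expanding c G" and c: "c > 0" and u: "u \<in> verts G"
    and large: "large_order c (card (verts G))"
    and PQ: "1 \<le> real P * linear_gain c" "1 \<le> real Q * ((\<alpha> - \<beta>) / (2 * \<beta>))"
  shows "card (verts G) < 2 * card (ball G u (P + Q))"
proof (rule ccontr)
  assume neg: "\<not> ?thesis"
  define n where "n = real (card (verts G))"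
  define \<zeta> where "\<zeta> = (\<alpha> - \<beta>) / (2 * \<beta>)"
  have simple: "simple_graph G" using G by (auto simp: expanding_def)
  have fin: "finite (verts G)" using simple by (simp add: simple_graph_def)
  then have "card (verts G) \<ge> 1" using u by (metis One_nat_def Suc_leI card_gt_0_iff empty_iff)
  then have n1: "n \<ge> 1" by (simp add: n_def)
  have g0: "linear_gain c > 0" using c by (rule linear_gain_pos)
  have \<zeta>0: "\<zeta> > 0" using par by (simp add: \<zeta>_def)
  have mono: "card (ball G u i) \<le> card (ball G u j)" if "i \<le> j" for i j
    using ball_subset_verts[OF simple u, of j] fin that ball_mono by (metis card_mono finite_subset)
  have half: "2 * card (ball G u i) \<le> card (verts G)" if "i \<le> P + Q" for i
    using neg mono[OF that] by linarith
  have "i \<le> P + Q \<Longrightarrow> \<exists>p q. p + q = i \<and> real p * (linear_gain c * n) \<le> card (ball G u i)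
      \<and> n powr (\<zeta> * q) \<le> card (ball G u i)" for i
  proof (induction i)
    case 0
    then show ?case using n1 by simp
  next
    case (Suc i)
    then obtain p q where pq: "p + q = i" "real p * (linear_gain c * n) \<le> card (ball G u i)"
      "n powr (\<zeta> * q) \<le> card (ball G u i)" by auto
    have m: "real (card (ball G u i)) \<le> card (ball G u (Suc i))" using mono[of i "Suc i"] by simp
    from ball_growth[OF G c u large half[of i]] Suc.prems
    consider "card (ball G u (Suc i)) \<ge> card (ball G u i) + linear_gain c * n"
      | "card (ball G u (Suc i)) \<ge> n powr \<zeta> * card (ball G u i)"
      by (auto simp: n_def \<zeta>_def)
    then show ?case
    proof cases
      case 1
      then have "real (Suc p) * (linear_gain c * n) \<le> card (ball G u (Suc i))"
        using pq(2) by (simp add: algebra_simps)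
      then show ?thesis using pq m by (intro exI[of _ "Suc p"] exI[of _ q]) auto
    next
      case 2
      have "n powr (\<zeta> * Suc q) = n powr \<zeta> * n powr (\<zeta> * q)"
        using n1 by (simp add: powr_add[symmetric] algebra_simps)
      also have "\<dots> \<le> n powr \<zeta> * card (ball G u i)" using pq(3) by (intro mult_left_mono) auto
      finally have "n powr (\<zeta> * Suc q) \<le> card (ball G u (Suc i))" using 2 by linarith
      then show ?thesis using pq m by (intro exI[of _ p] exI[of _ "Suc q"]) auto
    qed
  qed
  then obtain p q where pq: "p + q = P + Q" "real p * (linear_gain c * n) \<le> card (ball G u (P + Q))"
      "n powr (\<zeta> * q) \<le> card (ball G u (P + Q))" by blast
  have "n \<le> card (ball G u (P + Q))"
  proof (cases "P \<le> p")
    case True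
    have "1 * n \<le> (real P * linear_gain c) * n" using PQ(1) n1 by (intro mult_right_mono) auto
    also have "\<dots> \<le> (real p * linear_gain c) * n"
      using True g0 n1 by (intro mult_right_mono) auto
    finally show ?thesis using pq(2) by (simp add: mult.assoc)
  next
    case False
    then have "real Q * \<zeta> \<le> real q * \<zeta>" using pq(1) \<zeta>0 by (intro mult_right_mono) auto
    moreover have "1 \<le> real Q * \<zeta>" using PQ(2) unfolding \<zeta>_def .
    ultimately have "1 \<le> \<zeta> * q" by (simp add: mult.commute)
    then have "n powr 1 \<le> n powr (\<zeta> * q)" using n1 by (intro powr_mono) auto
    then show ?thesis using pq(3) n1 by simp
  qed
  moreover have "2 * real (card (ball G u (P + Q))) \<le> n"
    using neg by (simp add: n_def)
  ultimately show False using n1 by linarith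
qed

text \<open>Balanced parts are optimal: the left side is
  \<open>(a * b) powr (\<alpha> - 1) * a powr (2 - \<alpha>)\<close>, where the first factor is
  bounded by the inequality of arithmetic and geometric means and the second by
  \<open>a \<le> (a + b) / 2\<close>, using \<open>\<alpha> < 2\<close>.\<close>

lemma mult_powr_le_balanced:
  fixes a b :: real
  assumes "0 \<le> a" "a \<le> b"
  shows "a * b powr (\<alpha> - 1) \<le> ((a + b) / 2) powr \<alpha>"
proof (cases "a = 0")
  case False
  then have pos: "a > 0" "b > 0" using assms by auto
  have "a * b \<le> ((a + b) / 2) * ((a + b) / 2)"
    using zero_le_square[of "a - b"] by (simp add: field_simps)
  then have "(a * b) powr (\<alpha> - 1) \<le> (((a + b) / 2) * ((a + b) / 2)) powr (\<alpha> - 1)"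
    using pos par by (intro powr_mono2) auto
  also have "\<dots> = ((a + b) / 2) powr (2 * \<alpha> - 2)"
    using pos by (simp only: powr_mult powr_add[symmetric]) (simp add: powr_mult powr_add[symmetric])
  finally have "(a * b) powr (\<alpha> - 1) * a powr (2 - \<alpha>) \<le> ((a + b) / 2) powr (2 * \<alpha> - 2) * ((a + b) / 2) powr (2 - \<alpha>)"
    using pos par assms by (intro mult_mono powr_mono2) auto
  moreover have "(a * b) powr (\<alpha> - 1) * a powr (2 - \<alpha>) = a * b powr (\<alpha> - 1)"
  proof -
    have "a powr (\<alpha> - 1) * a powr (2 - \<alpha>) = a" using pos by (simp add: powr_add[symmetric])
    then show ?thesis using pos by (simp add: powr_mult mult_ac)
  qed
  moreover have "((a + b) / 2) powr (2 * \<alpha> - 2) * ((a + b) / 2) powr (2 - \<alpha>) = ((a + b) / 2) powr \<alpha>"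
    by (simp add: powr_add[symmetric])
  ultimately show ?thesis by simp
qed simp

lemma card_edges_bipartite_le:
  fixes H :: "nat graph"
  assumes "simple_graph H" "bipartite H" "graph_free \<F> H" "2 * N \<le> card (verts H)"
  shows "card (edges H) \<le> \<rho> * (card (verts H) / 2) powr \<alpha> + C * card (verts H) powr \<beta>"
proof -
  have fin: "finite (verts H)" using assms(1) by (simp add: simple_graph_def)
  obtain A B where AB: "bipartition H A B" "card A \<le> card B"
  proof -
    obtain A B where "bipartition H A B" using assms(2) by (auto simp: bipartite_def)
    moreover then have "bipartition H B A"
      unfolding bipartition_def by (metis Un_commute Int_commute insert_commute)
    ultimately show ?thesis using that by (metis nat_le_linear)
  qed
  then have "A \<union> B = verts H" "A \<inter> B = {}" by (auto simp: bipartition_def)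
  then have n: "card (verts H) = card A + card B" using fin by (metis card_Un_disjoint finite_Un)
  have "real (card (edges H)) \<le> zarankiewicz (card A) (card B) \<F>"
    using card_edges_bipartition_le_zarankiewicz AB(1) assms by (simp only: of_nat_le_iff)
  also have "\<dots> \<le> \<rho> * card A * card B powr (\<alpha> - 1) + C * card B powr \<beta>"
    using zarankiewicz_le n AB(2) assms(4) by auto
  also have "\<dots> \<le> \<rho> * (card (verts H) / 2) powr \<alpha> + C * card (verts H) powr \<beta>"
  proof (rule add_mono)
    show "\<rho> * card A * card B powr (\<alpha> - 1) \<le> \<rho> * (card (verts H) / 2) powr \<alpha>"
      using mult_powr_le_balanced[of "card A" "card B"] AB(2) par n by (simp add: mult.assoc)
    show "C * card B powr \<beta> \<le> C * card (verts H) powr \<beta>"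
      using par n by (intro mult_left_mono powr_mono2) auto
  qed
  finally show ?thesis .
qed

text \<open>An optimal \<open>\<F>\<close>-free bipartite graph with balanced parts contains no odd
  cycle, so it competes with \<open>G n\<close>. The errors from smoothness and from rounding
  \<open>n / 2\<close> are of order \<open>n powr \<beta>\<close>.\<close>

lemma extremal_card_edges_ge:
  assumes "extremal_family (\<F> \<union> {cycle_graph k}) G" "odd k" "N \<le> n div 2"
  shows "\<rho> * (n / 2) powr \<alpha> - (\<rho> + C) * n powr \<beta> \<le> card (edges (G n))"
proof (cases "n = 0")
  case False
  have G: "simple_graph (G n)" "card (verts (G n)) = n" "graph_free \<F> (G n)"
    and ex: "card (edges (G n)) = ex_number n (\<F> \<union> {cycle_graph k})"
    using assms(1) by (auto simp: extremal_family_def graph_free_def)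
  have fin: "finite (verts (G n))" using G by (simp add: simple_graph_def)
  define a b where "a = n div 2" and "b = n - n div 2"
  have ab: "a \<le> b" "a + b = n" "N \<le> b" "real a \<ge> (real n - 1) / 2" "real b \<ge> n / 2"
    using assms(3) by (auto simp: a_def b_def)
  let ?S = "{card (edges H) | (H :: nat graph) A B.
     simple_graph H \<and> bipartition H A B \<and> card A = a \<and> card B = b \<and> graph_free \<F> H}"
  have card_verts: "card (verts H) = n" if "simple_graph H" "bipartition H A B" "card A = a" "card B = b"
    for H :: "nat graph" and A B
  proof -
    have "A \<union> B = verts H" "A \<inter> B = {}" "finite (verts H)"
      using that by (auto simp: bipartition_def simple_graph_def)
    then show ?thesis using that ab by (metis card_Un_disjoint finite_Un)
  qed
  have bound: "card (edges H) \<le> n ^ 2" if "simple_graph H" "card (verts H) = n" for H :: "nat graph"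
    using simple_graph_card_edges_le that by metis
  have "?S \<subseteq> {..n ^ 2}" using bound card_verts by blast
  then have "finite ?S" by (rule finite_subset) simp
  \<comment> \<open>The maximum must be attained. The edgeless graph on the vertices of
    \<open>G n\<close> is \<open>\<F>\<close>-free because it is a subgraph of \<open>G n\<close>,
    even if \<open>\<F>\<close> has edgeless members.\<close>
  moreover have "?S \<noteq> {}"
  proof -
    obtain A where A: "A \<subseteq> verts (G n)" "card A = a"
      using ab G(2) by (metis le_add1 obtain_subset_with_card_n)
    let ?H = "(verts (G n), {})"
    have "is_subgraph ?H (G n)" using fin by (simp add: is_subgraph_def simple_graph_def)
    then have "simple_graph ?H" "graph_free \<F> ?H"
      using graph_free_subgraph[OF _ G(3)] by (simp add: is_subgraph_def, blast)
    moreover have "bipartition ?H A (verts (G n) - A)" using A by (auto simp: bipartition_def)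
    moreover have "card (verts (G n) - A) = b"
      using A G(2) ab fin by (simp add: card_Diff_subset finite_subset)
    ultimately have "card (edges ?H) \<in> ?S" using A(2) by blast
    then show ?thesis by blast
  qed
  ultimately have "Max ?S \<in> ?S" by (rule Max_in)
  then have "zarankiewicz a b \<F> \<in> ?S" unfolding zarankiewicz_def .
  then obtain H :: "nat graph" and A B where H: "simple_graph H" "bipartition H A B" "card A = a" "card B = b"
      "graph_free \<F> H" "card (edges H) = zarankiewicz a b \<F>"
    by (smt (verit) mem_Collect_eq)
  have "graph_free (\<F> \<union> {cycle_graph k}) H"
    using H(2,5) bipartite_no_odd_cycle[of H k] assms(2) by (auto simp: graph_free_def bipartite_def)
  moreover have "finite {card (edges G) | G :: nat graph. simple_graph G \<and> card (verts G) = n \<and>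
      graph_free (\<F> \<union> {cycle_graph k}) G}"
    by (rule finite_subset[of _ "{..n ^ 2}"]) (use bound in auto)
  ultimately have "card (edges H) \<le> ex_number n (\<F> \<union> {cycle_graph k})"
    unfolding ex_number_def using H(1) card_verts[OF H(1-4)] by (intro Max_ge) blast+
  then have z: "real (zarankiewicz a b \<F>) \<le> card (edges (G n))" using ex H(6) by simp
  have n1: "real n \<ge> 1" using False by simp
  \<comment> \<open>Rounding loses at most \<open>\<rho> * (n / 2) powr (\<alpha> - 1) / 2\<close>,
    which is absorbed because \<open>\<alpha> - 1 < 1 \<le> \<beta>\<close>.\<close>
  have "(real n - 1) / 2 * (n / 2) powr (\<alpha> - 1) \<le> a * b powr (\<alpha> - 1)"
    using ab par n1 by (intro mult_mono powr_mono2) auto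
  then have "\<rho> * ((real n - 1) / 2 * (n / 2) powr (\<alpha> - 1)) \<le> \<rho> * a * b powr (\<alpha> - 1)"
    using par by (simp add: mult.assoc)
  moreover have "(real n - 1) / 2 * (n / 2) powr (\<alpha> - 1) = (n / 2) powr \<alpha> - (n / 2) powr (\<alpha> - 1) / 2"
    using n1 by (simp add: powr_diff field_simps)
  ultimately have "\<rho> * (n / 2) powr \<alpha> - \<rho> * ((n / 2) powr (\<alpha> - 1) / 2) \<le> \<rho> * a * b powr (\<alpha> - 1)"
    by (simp only: right_diff_distrib)
  moreover
  have "(n / 2) powr (\<alpha> - 1) / 2 \<le> n powr \<beta>"
  proof -
    have "(n / 2) powr (\<alpha> - 1) \<le> n powr (\<alpha> - 1)" using n1 par by (intro powr_mono2) auto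
    also have "\<dots> \<le> n powr \<beta>" using n1 par by (intro powr_mono) auto
    finally show ?thesis using powr_ge_zero[of "n / 2" "\<alpha> - 1"] by linarith
  qed
  then have "\<rho> * ((n / 2) powr (\<alpha> - 1) / 2) \<le> \<rho> * n powr \<beta>" using par by (intro mult_left_mono) auto
  moreover have "C * b powr \<beta> \<le> C * n powr \<beta>"
    using par ab by (intro mult_left_mono powr_mono2) auto
  moreover have "\<rho> * a * b powr (\<alpha> - 1) - C * b powr \<beta> \<le> zarankiewicz a b \<F>"
    using smooth[OF ab(3,1)] by linarith
  ultimately show ?thesis using z unfolding distrib_right[of \<rho> C] by linarith
qed simp

end

section \<open>Near-extremal graphs\<close>

text \<open>\<open>n\<close> and \<open>e\<close> are the order and size of the whole graph,
  \<open>n'\<close> and \<open>m\<close> those of its densest part, and \<open>h\<close> counts the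
  edges of a bipartite subgraph of that part. With \<open>s = n' / n\<close>, the density comparison
  gives \<open>m \<ge> e * s powr \<gamma>\<close>. Comparing this with the upper bound on
  \<open>h\<close> forces \<open>s powr (\<alpha> - \<gamma>)\<close> to be at least a quantity
  close to 1 for small \<open>\<eta>\<close>, so little is lost in passing from \<open>e\<close> to
  \<open>h\<close>.\<close>

lemma near_extremal_transfer:
  fixes a e m h n n' \<alpha> \<gamma> \<eta> :: real
  assumes "0 < a" "0 < \<gamma>" "\<gamma> < \<alpha>" "0 < \<eta>" "\<eta> < 1" "0 < n" "0 < n'"
    and e: "(1 - \<eta>) * (a * n powr \<alpha>) \<le> e"
    and m: "e / n powr \<gamma> \<le> m / n' powr \<gamma>"
    and h: "(1 - \<eta>) * m \<le> h" "h \<le> (1 + \<eta>) * (a * n' powr \<alpha>)"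
  shows "(1 - \<eta>) * ((1 - \<eta>)\<^sup>2 / (1 + \<eta>)) powr (\<gamma> / (\<alpha> - \<gamma>)) * e \<le> h"
proof -
  define s where "s = n' / n"
  define q where "q = (1 - \<eta>)\<^sup>2 / (1 + \<eta>)"
  have s: "s > 0" "n' = s * n" using assms by (auto simp: s_def)
  have q: "q > 0" using assms by (simp add: q_def)
  have "0 < (1 - \<eta>) * (a * n powr \<alpha>)" using assms by simp
  then have e0: "e > 0" using e by linarith
  have "n' powr \<gamma> = s powr \<gamma> * n powr \<gamma>" using s assms by (simp add: powr_mult)
  then have ms: "e * s powr \<gamma> \<le> m"
    using m s assms by (simp add: field_simps)
  then have hs: "(1 - \<eta>) * (e * s powr \<gamma>) \<le> h"
    using h(1) assms by (meson diff_ge_0_iff_ge less_imp_le mult_left_mono order_trans)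
  have "(1 - \<eta>) * (a * n powr \<alpha>) * s powr \<gamma> \<le> e * s powr \<gamma>"
    using e by (intro mult_right_mono) auto
  then have "(1 - \<eta>) * ((1 - \<eta>) * (a * n powr \<alpha>) * s powr \<gamma>) \<le> h"
    using hs assms by (meson diff_ge_0_iff_ge less_imp_le mult_left_mono order_trans)
  also have "h \<le> (1 + \<eta>) * (a * (s powr \<alpha> * n powr \<alpha>))"
    using h(2) s assms by (simp add: powr_mult)
  finally have "((1 - \<eta>)\<^sup>2 * s powr \<gamma>) * (a * n powr \<alpha>) \<le> ((1 + \<eta>) * s powr \<alpha>) * (a * n powr \<alpha>)"
    by (simp add: power2_eq_square mult_ac)
  then have "(1 - \<eta>)\<^sup>2 * s powr \<gamma> \<le> (1 + \<eta>) * s powr \<alpha>"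
    using assms by (simp del: mult_le_cancel_right add: mult_le_cancel_right_pos)
  also have "s powr \<alpha> = s powr (\<alpha> - \<gamma>) * s powr \<gamma>" by (simp add: powr_add[symmetric])
  finally have "(1 - \<eta>)\<^sup>2 * s powr \<gamma> \<le> ((1 + \<eta>) * s powr (\<alpha> - \<gamma>)) * s powr \<gamma>" by (simp add: mult.assoc)
  then have "(1 - \<eta>)\<^sup>2 \<le> (1 + \<eta>) * s powr (\<alpha> - \<gamma>)" using s by simp
  then have "q \<le> s powr (\<alpha> - \<gamma>)" using assms by (simp add: q_def field_simps)
  then have "q powr (\<gamma> / (\<alpha> - \<gamma>)) \<le> (s powr (\<alpha> - \<gamma>)) powr (\<gamma> / (\<alpha> - \<gamma>))"
    using q assms by (intro powr_mono2) auto
  also have "\<dots> = s powr \<gamma>" using assms by (simp add: powr_powr)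
  finally have "(1 - \<eta>) * (e * q powr (\<gamma> / (\<alpha> - \<gamma>))) \<le> (1 - \<eta>) * (e * s powr \<gamma>)"
    using e0 assms by (intro mult_left_mono) auto
  then show ?thesis using hs by (simp add: q_def mult_ac)
qed

context smooth_family
begin

text \<open>Balls of radius \<open>P + Q\<close> exceed half of the vertices, so radius
  \<open>2 * (P + Q)\<close> reaches everything from any root. The layering argument asks for
  \<open>k\<close> above twice the depth, which is \<open>4 * (P + Q)\<close>.\<close>

lemma expanding_bipartite_subgraph:
  assumes G: "expanding c G" and c: "c > 0" and ne: "verts G \<noteq> {}"
    and large: "large_order c (card (verts G))"
    and PQ: "1 \<le> real P * linear_gain c" "1 \<le> real Q * ((\<alpha> - \<beta>) / (2 * \<beta>))"
    and k: "odd k" "4 * (P + Q) < k" "\<not> contains_copy G (cycle_graph k)"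
  shows "\<exists>H. is_subgraph H G \<and> bipartite H \<and> verts H = verts G \<and>
    card (edges G) \<le> card (edges H) + 2 * (P + Q) * (2 * k * card (verts G))"
proof -
  obtain v where v: "v \<in> verts G" using ne by auto
  have simple: "simple_graph G" using G by (simp add: expanding_def)
  have "ball G v (2 * (P + Q)) = verts G"
    using simple v ball_exceeds_half[OF G c _ large PQ] by (rule ball_large_imp_eq_verts)
  then interpret rooted_graph G v "2 * (P + Q)"
    using simple v by unfold_locales
  show ?thesis using large_bipartite_subgraph[of k] k by simp
qed

section \<open>Constants and thresholds for near-extremal graphs\<close>

lemma eventually_large_order:
  assumes "c > 0" shows "eventually (large_order c) at_top"
proof -
  have "filterlim (\<lambda>x. c * x powr (\<alpha> - 1)) at_top at_top"
    using assms par by real_asymp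
  then have "eventually (\<lambda>x. real N \<le> c * x powr (\<alpha> - 1)) at_top"
    unfolding filterlim_at_top by blast
  moreover have "filterlim (\<lambda>x::real. x powr ((\<alpha> - \<beta>) / 2)) at_top at_top"
    using assms par by real_asymp
  then have "eventually (\<lambda>x. 2 * C / c < x powr ((\<alpha> - \<beta>) / 2)) at_top"
    unfolding filterlim_at_top_dense by blast
  ultimately show ?thesis unfolding large_order_def by eventually_elim simp
qed

lemma eventually_powr_le:
  assumes "p < \<alpha>" "0 < b"
  shows "eventually (\<lambda>x. a * x powr p \<le> b * x powr \<alpha>) at_top"
proof -
  have "filterlim (\<lambda>x::real. b * x powr (\<alpha> - p)) at_top at_top"
    using assms by real_asymp
  then have "eventually (\<lambda>x. a \<le> b * x powr (\<alpha> - p)) at_top"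
    unfolding filterlim_at_top by blast
  then show ?thesis
    using eventually_gt_at_top[of 0]
  proof eventually_elim
    case (elim x)
    then have "a * x powr p \<le> b * x powr (\<alpha> - p) * x powr p" by (intro mult_right_mono) auto
    then show ?case by (simp add: mult.assoc powr_add[symmetric])
  qed
qed

text \<open>Midway between 1 and \<open>\<alpha>\<close>: above 1, so that cuts of the densest part
  carry edges, and below \<open>\<alpha>\<close>, so that the densest part grows with the
  graph.\<close>

definition \<gamma> :: real where "\<gamma> = (1 + \<alpha>) / 2"
text \<open>The coefficient for which
  \<open>\<rho> * (n / 2) powr \<alpha> = density * n powr \<alpha>\<close>.\<close>

definition density :: real where "density = \<rho> / 2 powr \<alpha>"
definition expansion :: real where "expansion = (1 - 2 powr (1 - \<gamma>)) * (density / 2)"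

lemma \<gamma>: "1 < \<gamma>" "\<gamma> < \<alpha>" "\<gamma> < 2"
  using par by (auto simp: \<gamma>_def)

lemma density_pos: "density > 0" using par by (simp add: density_def)

lemma expansion_pos: "expansion > 0"
proof -
  have "2 powr (1 - \<gamma>) < 2 powr (0::real)" using \<gamma> by (intro powr_less_mono) auto
  then show ?thesis using density_pos by (simp add: expansion_def)
qed

text \<open>The maximal ratio is at least \<open>density / 2 * n powr (\<alpha> - \<gamma>)\<close>.
  As \<open>card X \<le> n\<close>, this makes the part on \<open>X\<close> about as dense as
  required of \<open>G\<close>, and its cut bound becomes expansion. Since a part has at most
  \<open>(card X)\<^sup>2\<close> edges, the ratio also forces \<open>card X\<close> to grow with
  \<open>n\<close>.\<close>

lemma densest_subgraph_of_near_extremal: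
  fixes G :: "nat graph"
  assumes G: "simple_graph G" "graph_free \<F> G" "verts G \<noteq> {}"
    and e: "density / 2 * card (verts G) powr \<alpha> \<le> card (edges G)"
  obtains X where "X \<subseteq> verts G" "X \<noteq> {}" "expanding expansion (induced G X)"
    "card (edges G) / card (verts G) powr \<gamma> \<le> card (edges (induced G X)) / card X powr \<gamma>"
    "density / 2 * card X powr \<alpha> \<le> card (edges (induced G X))"
    "density / 2 * card (verts G) powr (\<alpha> - \<gamma>) \<le> (card X)\<^sup>2"
proof -
  have fin: "finite (verts G)" using G by (simp add: simple_graph_def)
  define n where "n = real (card (verts G))"
  have n: "n \<ge> 1" using fin G(3) by (simp add: n_def Suc_le_eq card_gt_0_iff)
  have "0 < density / 2 * n powr \<alpha>" using density_pos n by simp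
  then have "card (edges G) > 0" using e by (simp add: n_def)
  then have "edges G \<noteq> {}" by auto
  from densest_induced_subgraph_expands[OF G(1) this \<gamma>(1)]
  obtain X where X: "X \<subseteq> verts G" "X \<noteq> {}"
    "card (edges G) / n powr \<gamma> \<le> card (edges (induced G X)) / card X powr \<gamma>"
    "\<And>Y. \<lbrakk>Y \<subseteq> X; Y \<noteq> {}; 2 * card Y \<le> card X\<rbrakk> \<Longrightarrow>
      (1 - 2 powr (1 - \<gamma>)) * (card (edges (induced G X)) / card X) * card Y
        \<le> card (cut (induced G X) Y (X - Y))"
    unfolding n_def by blast
  define x where "x = real (card X)"
  define m where "m = real (card (edges (induced G X)))"
  have "finite X" using X(1) fin by (rule finite_subset)
  then have x: "x \<ge> 1" using X(2) by (simp add: x_def Suc_le_eq card_gt_0_iff)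
  have xn: "x \<le> n" using X(1) fin by (simp add: x_def n_def card_mono)
  have simple: "simple_graph (induced G X)" using G(1) X(1) by (rule simple_graph_induced)
  have "density / 2 * n powr (\<alpha> - \<gamma>) = (density / 2 * n powr \<alpha>) / n powr \<gamma>"
    using n by (simp add: powr_diff)
  also have "\<dots> \<le> card (edges G) / n powr \<gamma>" using e by (intro divide_right_mono) (auto simp: n_def)
  also have "\<dots> \<le> m / x powr \<gamma>" using X(3) by (simp add: m_def x_def)
  finally have *: "density / 2 * n powr (\<alpha> - \<gamma>) \<le> m / x powr \<gamma>" .
  have "density / 2 * x powr (\<alpha> - \<gamma>) \<le> density / 2 * n powr (\<alpha> - \<gamma>)"
    using xn x \<gamma> density_pos by (intro mult_left_mono powr_mono2) auto
  then have "density / 2 * x powr (\<alpha> - \<gamma>) \<le> m / x powr \<gamma>" using * by linarith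
  then have "density / 2 * (x powr (\<alpha> - \<gamma>) * x powr \<gamma>) \<le> m" using x by (simp add: field_simps)
  then have m: "density / 2 * x powr \<alpha> \<le> m" by (simp add: powr_add[symmetric])
  have "m / x powr \<gamma> \<le> m / 1"
    using x \<gamma> by (intro divide_left_mono) (auto simp: m_def ge_one_powr_ge_zero)
  also have "m \<le> x\<^sup>2"
    using simple_graph_card_edges_le[OF simple] by (simp add: m_def x_def flip: of_nat_power)
  finally have sq: "density / 2 * n powr (\<alpha> - \<gamma>) \<le> x\<^sup>2" using * by linarith
  have "expanding expansion (induced G X)"
    unfolding expanding_def verts_induced
  proof (intro conjI allI impI)
    show "simple_graph (induced G X)" by (rule simple)
    show "graph_free \<F> (induced G X)"
      using induced_subgraph[OF G(1) X(1)] G(2) by (rule graph_free_subgraph)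
    fix Y assume Y: "Y \<subseteq> X" "Y \<noteq> {}" "2 * card Y \<le> card X"
    have pos: "1 - 2 powr (1 - \<gamma>) > 0"
      using expansion_pos density_pos by (simp add: expansion_def zero_less_mult_iff)
    have "expansion * x powr (\<alpha> - 1) * card Y = (1 - 2 powr (1 - \<gamma>)) * ((density / 2 * x powr \<alpha>) / x) * card Y"
      using x by (simp add: expansion_def powr_diff)
    also have "\<dots> \<le> (1 - 2 powr (1 - \<gamma>)) * (m / x) * card Y"
      using pos m x by (intro mult_right_mono mult_left_mono divide_right_mono) auto
    also have "\<dots> \<le> card (cut (induced G X) Y (X - Y))"
      using X(4)[OF Y] by (simp add: m_def x_def)
    finally show "expansion * card X powr (\<alpha> - 1) * card Y \<le> card (cut (induced G X) Y (X - Y))"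
      by (simp add: x_def)
  qed
  then show ?thesis
    using that[of X] X(1-3) m sq by (simp add: n_def x_def m_def)
qed

lemma eventually_near_bipartite:
  fixes \<epsilon> :: real
  assumes PQ: "1 \<le> real P * linear_gain expansion" "1 \<le> real Q * ((\<alpha> - \<beta>) / (2 * \<beta>))"
    and k: "odd k" "4 * (P + Q) < k"
    and ext: "extremal_family (\<F> \<union> {cycle_graph k}) G"
    and \<epsilon>: "\<epsilon> > 0"
  shows "eventually (\<lambda>n. card (edges (G n)) > 0 \<and>
    (\<exists>H. is_subgraph H (G n) \<and> bipartite H \<and> (1 - \<epsilon>) * card (edges (G n)) \<le> card (edges H))) sequentially"
proof -
  \<comment> \<open>The fraction of edges kept by \<open>near_extremal_transfer\<close>. It tends to
    1 as \<open>\<eta>\<close> tends to 0, so a suitable \<open>\<eta>\<close> exists for the given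
    \<open>\<epsilon>\<close>.\<close>
  define \<psi> where "\<psi> \<eta> = (1 - \<eta>) * ((1 - \<eta>)\<^sup>2 / (1 + \<eta>)) powr (\<gamma> / (\<alpha> - \<gamma>))" for \<eta> :: real
  have "((\<lambda>\<eta>::real. (1 - \<eta>) * ((1 - \<eta>)\<^sup>2 / (1 + \<eta>)) powr (\<gamma> / (\<alpha> - \<gamma>))) \<longlongrightarrow>
      (1 - 0) * ((1 - 0)\<^sup>2 / (1 + 0)) powr (\<gamma> / (\<alpha> - \<gamma>))) (at_right 0)"
    by (intro tendsto_intros) auto
  then have "(\<psi> \<longlongrightarrow> 1) (at_right 0)" by (simp add: \<psi>_def[abs_def])
  then have "eventually (\<lambda>\<eta>. \<psi> \<eta> > 1 - \<epsilon>) (at_right 0)"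
    using \<epsilon> by (intro order_tendstoD) auto
  moreover have "eventually (\<lambda>\<eta>::real. \<eta> \<in> {0<..<1/2}) (at_right 0)"
    by (rule eventually_at_right_real) simp
  ultimately have "eventually (\<lambda>\<eta>. \<psi> \<eta> > 1 - \<epsilon> \<and> \<eta> \<in> {0<..<1/2}) (at_right 0)"
    by (rule eventually_conj)
  then obtain \<eta> where \<eta>: "\<psi> \<eta> > 1 - \<epsilon>" "0 < \<eta>" "\<eta> < 1 / 2"
    using eventually_happens[of _ "at_right (0::real)"] by fastforce
  \<comment> \<open>The number of edges lost inside the layers, per vertex of
    \<open>X\<close>.\<close>
  define K where "K = 2 * real (P + Q) * (2 * k)"
  have \<eta>d: "0 < \<eta> * (density / 2)" "0 < \<eta> * density" using \<eta> density_pos by auto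
  have "eventually (\<lambda>x. large_order expansion x \<and> K * x powr 1 \<le> \<eta> * (density / 2) * x powr \<alpha> \<and>
      C * x powr \<beta> \<le> \<eta> * density * x powr \<alpha> \<and> 2 * real N \<le> x) at_top"
    using par \<eta>d
    by (intro eventually_conj eventually_large_order expansion_pos eventually_powr_le eventually_ge_at_top) auto
  then obtain x0' where "\<And>x. x \<ge> x0' \<Longrightarrow> large_order expansion x \<and> K * x powr 1 \<le> \<eta> * (density / 2) * x powr \<alpha> \<and>
      C * x powr \<beta> \<le> \<eta> * density * x powr \<alpha> \<and> 2 * real N \<le> x"
    unfolding eventually_at_top_linorder by blast
  then obtain x0 where x0: "x0 \<ge> 0" and large: "\<And>x. x \<ge> x0 \<Longrightarrow>
      large_order expansion x \<and> K * x powr 1 \<le> \<eta> * (density / 2) * x powr \<alpha> \<and>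
      C * x powr \<beta> \<le> \<eta> * density * x powr \<alpha> \<and> 2 * real N \<le> x"
    using that[of "max 0 x0'"] by fastforce
  \<comment> \<open>The estimates above are needed at \<open>card X\<close>, not at
    \<open>n\<close>; the lower bound on \<open>(card X)\<^sup>2\<close> turns large
    \<open>n\<close> into \<open>card X \<ge> x0\<close>.\<close>
  have "filterlim (\<lambda>x. density / 2 * x powr (\<alpha> - \<gamma>)) at_top at_top"
    using density_pos \<gamma> by real_asymp
  then have "eventually (\<lambda>x. x0\<^sup>2 \<le> density / 2 * x powr (\<alpha> - \<gamma>)) at_top"
    unfolding filterlim_at_top by blast
  then have "eventually (\<lambda>x. (\<rho> + C) * x powr \<beta> \<le> \<eta> * density * x powr \<alpha> \<and>
      x0\<^sup>2 \<le> density / 2 * x powr (\<alpha> - \<gamma>) \<and> 2 * real N \<le> x \<and> 1 \<le> x) at_top"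
    using par \<eta>d by (intro eventually_conj eventually_powr_le eventually_ge_at_top) auto
  then have "eventually (\<lambda>n. (\<rho> + C) * real n powr \<beta> \<le> \<eta> * density * real n powr \<alpha> \<and>
      x0\<^sup>2 \<le> density / 2 * real n powr (\<alpha> - \<gamma>) \<and> 2 * real N \<le> real n \<and> 1 \<le> real n) sequentially"
    by (rule eventually_compose_filterlim[OF _ filterlim_real_sequentially])
  then show ?thesis
  proof eventually_elim
    case (elim n)
    have G: "simple_graph (G n)" "card (verts (G n)) = n" "graph_free \<F> (G n)"
      "\<not> contains_copy (G n) (cycle_graph k)"
      using ext by (auto simp: extremal_family_def graph_free_def)
    have n: "n \<ge> 1" "N \<le> n div 2" using elim by auto
    have ne: "verts (G n) \<noteq> {}" using G(2) n by auto
    have "\<rho> * (n / 2) powr \<alpha> = density * n powr \<alpha>" by (simp add: density_def powr_divide)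
    then have e: "(1 - \<eta>) * (density * n powr \<alpha>) \<le> card (edges (G n))"
      using extremal_card_edges_ge[OF ext k(1) n(2)] elim by (simp add: algebra_simps)
    \<comment> \<open>As \<open>\<eta> < 1 / 2\<close>, at least half of the density remains, as
      required for extracting \<open>X\<close>.\<close>
    have "1 / 2 * (density * n powr \<alpha>) \<le> (1 - \<eta>) * (density * n powr \<alpha>)"
      using \<eta> density_pos by (intro mult_right_mono) auto
    then have e2: "density / 2 * n powr \<alpha> \<le> card (edges (G n))" using e by simp
    moreover have "0 < density / 2 * n powr \<alpha>" using density_pos n by simp
    ultimately have e0: "card (edges (G n)) > 0" by linarith
    obtain X where X: "X \<subseteq> verts (G n)" "X \<noteq> {}" "expanding expansion (induced (G n) X)"
      "card (edges (G n)) / n powr \<gamma> \<le> card (edges (induced (G n) X)) / card X powr \<gamma>"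
      "density / 2 * card X powr \<alpha> \<le> card (edges (induced (G n) X))"
      "density / 2 * n powr (\<alpha> - \<gamma>) \<le> (card X)\<^sup>2"
      using densest_subgraph_of_near_extremal[OF G(1,3) ne] e2 unfolding G(2) by blast
    define G' where "G' = induced (G n) X"
    define x where "x = real (card X)"
    have sub: "is_subgraph G' (G n)" unfolding G'_def using G(1) X(1) by (rule induced_subgraph)
    have "x0\<^sup>2 \<le> x\<^sup>2" using elim X(6) by (simp add: x_def)
    then have "x0 \<le> x" by (rule power2_le_imp_le) (simp add: x_def)
    note lx = large[OF this]
    have "finite X" using X(1) G(1) finite_subset by (auto simp: simple_graph_def)
    then have xpos: "x > 0" using X(2) by (simp add: x_def card_gt_0_iff)
    have "\<not> contains_copy G' (cycle_graph k)"
      using graph_free_subgraph[OF sub, of "{cycle_graph k}"] G(4) by (simp add: graph_free_def)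
    moreover have VG': "verts G' = X" by (simp add: G'_def)
    moreover have "large_order expansion (card (verts G'))" using lx VG' by (simp add: x_def)
    ultimately have "\<exists>H. is_subgraph H G' \<and> bipartite H \<and> verts H = verts G' \<and>
        card (edges G') \<le> card (edges H) + 2 * (P + Q) * (2 * k * card (verts G'))"
      using X(2) by (intro expanding_bipartite_subgraph[OF X(3)[folded G'_def] expansion_pos _ _ PQ k]) auto
    then obtain H where H: "is_subgraph H G'" "bipartite H" "verts H = X"
      "card (edges G') \<le> card (edges H) + 2 * (P + Q) * (2 * k * card X)"
      unfolding VG' by blast
    have Hfree: "simple_graph H" "graph_free \<F> H"
      using H(1) sub G(3) graph_free_subgraph is_subgraph_trans unfolding is_subgraph_def by metis+
    have "real (card (edges G')) \<le> card (edges H) + K * x"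
      using of_nat_mono[OF H(4), where 'a = real] by (simp add: K_def x_def)
    moreover have "K * x \<le> \<eta> * card (edges G')"
    proof -
      have "K * x \<le> \<eta> * (density / 2 * x powr \<alpha>)" using lx xpos by (simp add: mult.assoc)
      also have "\<dots> \<le> \<eta> * card (edges G')" using X(5) \<eta> by (intro mult_left_mono) (auto simp: G'_def x_def)
      finally show ?thesis .
    qed
    ultimately have low: "(1 - \<eta>) * card (edges G') \<le> card (edges H)" by (simp add: algebra_simps)
    have "card (edges H) \<le> \<rho> * (x / 2) powr \<alpha> + C * x powr \<beta>"
      using card_edges_bipartite_le[OF Hfree(1) H(2) Hfree(2)] H(3) lx by (simp add: x_def)
    also have "\<rho> * (x / 2) powr \<alpha> = density * x powr \<alpha>" by (simp add: density_def powr_divide)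
    finally have up: "card (edges H) \<le> (1 + \<eta>) * (density * x powr \<alpha>)"
      using lx by (simp add: algebra_simps)
    have "\<psi> \<eta> * card (edges (G n)) \<le> card (edges H)"
      unfolding \<psi>_def
      by (rule near_extremal_transfer[OF density_pos _ _ _ _ _ _ e X(4)[folded G'_def x_def] low up])
        (use \<gamma> \<eta> n xpos in auto)
    moreover have "(1 - \<epsilon>) * card (edges (G n)) \<le> \<psi> \<eta> * card (edges (G n))"
      using \<eta> by (intro mult_right_mono) auto
    ultimately have "(1 - \<epsilon>) * card (edges (G n)) \<le> card (edges H)" by linarith
    then show ?case using e0 H(1,2) sub is_subgraph_trans by blast
  qed
qed

end

text \<open>The subgraphs must be chosen once for all \<open>\<epsilon>\<close>. A bipartite
  subgraph with the most edges serves, since it is at least as good as the witness for each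
  \<open>\<epsilon>\<close>.\<close>

lemma near_bipartite_rangeI:
  fixes G :: "nat \<Rightarrow> nat graph"
  assumes G: "\<And>n. simple_graph (G n)" "\<And>n. card (verts (G n)) = n"
    and approx: "\<And>\<epsilon> :: real. \<epsilon> > 0 \<Longrightarrow> eventually (\<lambda>n. card (edges (G n)) > 0 \<and>
      (\<exists>H. is_subgraph H (G n) \<and> bipartite H \<and> (1 - \<epsilon>) * card (edges (G n)) \<le> card (edges H))) sequentially"
  shows "near_bipartite (range G)"
proof -
  define best where "best K H \<longleftrightarrow> (is_subgraph H K \<and> bipartite H) \<and>
    (\<forall>H'. is_subgraph H' K \<and> bipartite H' \<longrightarrow> card (edges H') \<le> card (edges H))" for K H :: "nat graph"
  define H where "H K = (SOME H. best K H)" for K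
  have card_le: "card (edges H') \<le> card (edges K)" if "is_subgraph H' K" "simple_graph K" for H' K :: "nat graph"
    using that simple_graph_finite_edges[of K] by (auto simp: is_subgraph_def intro: card_mono)
  have H: "best K (H K)" if "simple_graph K" for K
  proof -
    have "is_subgraph ({}, {}) K \<and> bipartite ({} :: nat set, {} :: nat set set)"
      by (auto simp: is_subgraph_def simple_graph_def bipartite_def bipartition_def)
    then have "\<exists>H. best K H"
      unfolding best_def
      using ex_has_greatest_nat[of "\<lambda>H. is_subgraph H K \<and> bipartite H" "({}, {})" "\<lambda>H. card (edges H)" "Suc (card (edges K))"]
        card_le that by (auto simp: less_Suc_eq_le)
    then show ?thesis unfolding H_def by (rule someI_ex)
  qed
  have "((\<lambda>K. real (card (edges (H K))) / real (card (edges K))) \<longlongrightarrow> 1)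
      (inf (filtercomap (\<lambda>K. card (verts K)) at_top) (principal (range G)))"
  proof (rule tendstoI)
    fix \<epsilon> :: real assume "\<epsilon> > 0"
    then have "\<epsilon> / 2 > 0" by simp
    from approx[OF this] obtain n0 where n0: "\<And>n. n \<ge> n0 \<Longrightarrow> card (edges (G n)) > 0 \<and>
      (\<exists>H. is_subgraph H (G n) \<and> bipartite H \<and> (1 - \<epsilon> / 2) * card (edges (G n)) \<le> card (edges H))"
      unfolding eventually_sequentially by blast
    have close: "dist (real (card (edges (H (G n)))) / real (card (edges (G n)))) 1 < \<epsilon>" if n: "n \<ge> n0" for n
    proof -
      obtain H' where e: "card (edges (G n)) > 0" and H': "is_subgraph H' (G n)" "bipartite H'"
        "(1 - \<epsilon> / 2) * card (edges (G n)) \<le> card (edges H')" using n0[OF n] by blast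
      have "card (edges H') \<le> card (edges (H (G n)))" "card (edges (H (G n))) \<le> card (edges (G n))"
        using H[OF G(1)[of n]] H'(1,2) card_le[OF _ G(1)[of n]] unfolding best_def by blast+
      then have "(1 - \<epsilon> / 2) * card (edges (G n)) \<le> card (edges (H (G n)))"
        "real (card (edges (H (G n)))) \<le> card (edges (G n))" using H'(3) by auto
      then have "1 - \<epsilon> / 2 \<le> real (card (edges (H (G n)))) / real (card (edges (G n)))"
        "real (card (edges (H (G n)))) / real (card (edges (G n))) \<le> 1"
        using e by (auto simp: field_simps)
      then show ?thesis using \<open>\<epsilon> > 0\<close> by (simp add: dist_real_def)
    qed
    show "eventually (\<lambda>K. dist (real (card (edges (H K))) / real (card (edges K))) 1 < \<epsilon>)
      (inf (filtercomap (\<lambda>K. card (verts K)) at_top) (principal (range G)))"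
      unfolding eventually_inf_principal eventually_filtercomap_at_top_linorder
    \<comment> \<open>The order of a member of the family is its index, so large order means large
      index.\<close>
    proof (intro exI[of _ n0] allI impI)
      fix K assume "n0 \<le> card (verts K)" "K \<in> range G"
      then obtain n where "K = G n" "n0 \<le> n" using G(2) by auto
      then show "dist (real (card (edges (H K))) / real (card (edges K))) 1 < \<epsilon>"
        using close by simp
    qed
  qed
  moreover have "\<forall>K\<in>range G. is_subgraph (H K) K \<and> bipartite (H K)"
    using H G(1) unfolding best_def by auto
  ultimately show ?thesis unfolding near_bipartite_def by blast
qed

section \<open>Choice of the threshold for odd cycle lengths\<close>

theorem theorem1p4:
  fixes \<F> :: "nat graph set" and \<alpha> \<beta> \<rho> :: real
  assumes "\<forall>F\<in>\<F>. simple_graph F \<and> bipartite F"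
    and "1 \<le> \<beta>" and "\<beta> < \<alpha>" and "\<alpha> < 2"
    and "smooth_with_density \<alpha> \<beta> \<rho> \<F>"
    and "\<rho> > 0"
  shows "\<exists>k0. \<forall>k\<ge>k0. odd k \<longrightarrow>
           (\<forall>G. extremal_family (\<F> \<union> {cycle_graph k}) G \<longrightarrow> near_bipartite (range G))"
proof -
  obtain C N where CN: "\<forall>n\<ge>N. \<forall>m\<le>n.
      \<bar>real (zarankiewicz m n \<F>) - \<rho> * real m * real n powr (\<alpha> - 1)\<bar> \<le> C * real n powr \<beta>"
    using assms(5) unfolding smooth_with_density_def by blast
  interpret smooth_family \<F> \<alpha> \<beta> \<rho> "max 1 C" N
  proof
    fix m n :: nat assume "N \<le> n" "m \<le> n"
    then have "\<bar>real (zarankiewicz m n \<F>) - \<rho> * real m * real n powr (\<alpha> - 1)\<bar> \<le> C * real n powr \<beta>"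
      using CN by blast
    also have "\<dots> \<le> max 1 C * real n powr \<beta>" by (intro mult_right_mono) auto
    finally show "\<bar>real (zarankiewicz m n \<F>) - \<rho> * real m * real n powr (\<alpha> - 1)\<bar> \<le> max 1 C * real n powr \<beta>" .
  qed (use assms in auto)
  \<comment> \<open>\<open>P\<close> and \<open>Q\<close> depend only on the smoothness data, hence
    so does the threshold \<open>4 * (P + Q) + 1\<close>; neither \<open>k\<close> nor the extremal
    family enters.\<close>
  obtain P where P: "1 \<le> real P * linear_gain expansion"
    using linear_gain_pos[OF expansion_pos] ex_less_of_nat_mult less_imp_le by metis
  have "0 < (\<alpha> - \<beta>) / (2 * \<beta>)" using assms by simp
  then obtain Q where Q: "1 \<le> real Q * ((\<alpha> - \<beta>) / (2 * \<beta>))"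
    using ex_less_of_nat_mult less_imp_le by metis
  show ?thesis
  proof (intro exI[of _ "Suc (4 * (P + Q))"] allI impI)
    fix k G assume "Suc (4 * (P + Q)) \<le> k" "odd k" "extremal_family (\<F> \<union> {cycle_graph k}) G"
    then show "near_bipartite (range G)"
      using eventually_near_bipartite[OF P Q, of k G]
      by (intro near_bipartite_rangeI) (auto simp: extremal_family_def)
  qed
qed

end
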